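(* Let $n\ge0$ and let $\lambda$ be a partition with $l(\lambda)\le 2n+1$, regarded as a vector $(\lambda_1,\dots,\lambda_{2n+1})$ with $2n+1$ parts (zeros allowed). Let $\alpha\in\mathbb{C}$. Then $$\frac{1+\alpha}{\int_T\tilde\Delta_K^{(n)}(x;1,-t,\sqrt t,-\sqrt t;t)\,dT}\int_T P_\lambda(x_1^{\pm1},\dots,x_n^{\pm1},-1;t)\,\tilde\Delta_K^{(n)}(x;1,-t,\sqrt t,-\sqrt t;t)\prod_{i=1}^n(1-\alpha x_i^{\pm1})\,dT$$ $$=\frac{\phi_{2n+1}(t)}{v_\lambda(t)(1-t)^{2n+1}}\Big[(-\alpha)^{\#\text{ of odd parts of }\lambda}-(-\alpha)^{\#\text{ of even parts of }\lambda}\Big].$$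
   Context: Let $t\in\mathbb{C}$ with $|t|<1$ and fix a square root $\sqrt t$. $T=\{(x_1,\dots,x_k):|x_1|=\dots=|x_k|=1\}$ is the torus in the variables of integration, $dT=\prod_j \frac{dx_j}{2\pi\sqrt{-1}\,x_j}$ (when there are no variables, the integral is evaluation). $[i]=(1-t^i)/(1-t)$, $[m]!=[m][m-1]\cdots[1]$, $[0]!=1$; $\phi_r(t)=(1-t)(1-t^2)\cdots(1-t^r)$. For a partition $\lambda$ with $N$ parts (zeros included), $m_i(\lambda)$ is the number of $j\in\{1,\dots,N\}$ with $\lambda_j=i$, and $v_\lambda(t)=\prod_{i\ge0}[m_i(\lambda)]!$ (zero parts are counted). The Hall--Littlewood polynomial in $N$ variables is $P_\lambda(z_1,\dots,z_N;t)=\frac{1}{v_\lambda(t)}\sum_{w\in S_N}w\Big(z^\lambda\prod_{1\le i<j\le N}\frac{z_i-tz_j}{z_i-z_j}\Big)$, with $w$ permuting the subscripts of the variables. $P_\lambda(x_1^{\pm1},\dots,x_n^{\pm1},-1;t)$ is its value at the $2n+1$ arguments $x_1,x_1^{-1},\dots,x_n,x_n^{-1},-1$. The symmetric Koornwinder density is $$\tilde\Delta_K^{(k)}(x;a,b,c,d;t)=\frac{1}{2^kk!}\prod_{1\le i\le k}\frac{1-x_i^{\pm2}}{(1-ax_i^{\pm1})(1-bx_i^{\pm1})(1-cx_i^{\pm1})(1-dx_i^{\pm1})}\prod_{1\le i<j\le k}\frac{1-x_i^{\pm1}x_j^{\pm1}}{1-tx_i^{\pm1}x_j^{\pm1}},$$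 where an expression with $\pm$ signs denotes the product over all choices of signs, e.g. $1-x_i^{\pm2}$ means $(1-x_i^2)(1-x_i^{-2})$, $1-\alpha x_i^{\pm1}$ means $(1-\alpha x_i)(1-\alpha x_i^{-1})$, and $1-x_i^{\pm1}x_j^{\pm1}$ is a product of four factors. Common factors (when a parameter equals $\pm1$) are cancelled. The numbers of odd and even parts of $\lambda$ are counted among all $2n+1$ entries, a zero entry being an even part. *)

theory Defs
  imports "HOL-Analysis.Analysis" "HOL-Combinatorics.Permutations"
begin

text \<open>
  A partition with \<open>N\<close> parts, zero parts included, is a weakly decreasing list of length \<open>N\<close>.
\<close>

definition is_partition :: "nat \<Rightarrow> nat list \<Rightarrow> bool" where
  "is_partition N lam \<longleftrightarrow> length lam = N \<and> sorted_wrt (\<ge>) lam"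

definition t_int :: "complex \<Rightarrow> nat \<Rightarrow> complex" where
  "t_int t i = (1 - t ^ i) / (1 - t)"

definition t_fact :: "complex \<Rightarrow> nat \<Rightarrow> complex" where
  "t_fact t m = (\<Prod>i=1..m. t_int t i)"

definition t_phi :: "nat \<Rightarrow> complex \<Rightarrow> complex" where
  "t_phi r t = (\<Prod>i=1..r. 1 - t ^ i)"

text \<open>
  The product over all \<open>i \<ge> 0\<close> is taken over the values that occur in \<open>lam\<close> (zero included if it
  occurs); for all other \<open>i\<close> the multiplicity is 0 and the factor is 1.
\<close>

definition HL_v :: "nat list \<Rightarrow> complex \<Rightarrow> complex" where
  "HL_v lam t = (\<Prod>i\<in>set lam. t_fact t (count_list lam i))"

text \<open>
  The value of \<open>P_lam(z;t)\<close> at a list \<open>z\<close> of \<open>N = length lam\<close> arguments, indices running from 0.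
  The formula gives the value of the polynomial whenever the arguments are pairwise distinct.
  At the remaining points the convention \<open>a / 0 = 0\<close> makes it differ from the polynomial; for
  the arguments \<open>x_1, 1/x_1, ..., x_n, 1/x_n, -1\<close> these points form a null set of the torus,
  which no integral below can see.
\<close>

definition hall_littlewood :: "nat list \<Rightarrow> complex list \<Rightarrow> complex \<Rightarrow> complex" where
  "hall_littlewood lam z t =
     1 / HL_v lam t *
     (\<Sum>w | w permutes {..<length lam}.
        (\<Prod>i<length lam. (z ! w i) ^ (lam ! i)) *
        (\<Prod>j<length lam. \<Prod>i<j. (z ! w i - t * z ! w j) / (z ! w i - z ! w j)))"

definition pm_args :: "nat \<Rightarrow> (nat \<Rightarrow> complex) \<Rightarrow> complex list" where
  "pm_args n x = concat (map (\<lambda>i. [x i, inverse (x i)]) [0..<n])"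

definition one_minus_pm :: "complex \<Rightarrow> complex \<Rightarrow> complex" where
  "one_minus_pm a y = (1 - a * y) * (1 - a * inverse y)"

definition one_minus_pm2 :: "complex \<Rightarrow> complex \<Rightarrow> complex \<Rightarrow> complex" where
  "one_minus_pm2 a y z =
     (1 - a * y * z) * (1 - a * y * inverse z) *
     (1 - a * inverse y * z) * (1 - a * inverse y * inverse z)"

text \<open>
  The symmetric Koornwinder density (at \<open>q = 0\<close>) in the variables \<open>x 0, ..., x (k - 1)\<close>. If a
  parameter is 1 or -1, the quotient agrees with its cancelled form except where the cancelled
  factor vanishes, again a null set of the torus.
\<close>

definition koornwinder_density ::
  "nat \<Rightarrow> (nat \<Rightarrow> complex) \<Rightarrow> complex \<Rightarrow> complex \<Rightarrow> complex \<Rightarrow> complex \<Rightarrow> complex \<Rightarrow> complex" where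
  "koornwinder_density k x a b c d t =
     1 / (2 ^ k * fact k) *
     (\<Prod>i<k. one_minus_pm 1 ((x i)\<^sup>2) /
        (one_minus_pm a (x i) * one_minus_pm b (x i) * one_minus_pm c (x i) * one_minus_pm d (x i))) *
     (\<Prod>j<k. \<Prod>i<j. one_minus_pm2 1 (x i) (x j) / one_minus_pm2 t (x i) (x j))"

text \<open>
  Integration over the torus \<open>|x_1| = ... = |x_k| = 1\<close> against the product of the
  \<open>dx_j / (2 pi i x_j)\<close>: with \<open>x_j = cis (theta_j)\<close> each of these is \<open>d theta_j / (2 pi)\<close>, the
  uniform distribution on \<open>[0, 2 pi]\<close>. For \<open>k = 0\<close> the product measure is a point mass.
\<close>

definition torus_integral :: "nat \<Rightarrow> ((nat \<Rightarrow> complex) \<Rightarrow> complex) \<Rightarrow> complex" where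
  "torus_integral k f =
     (LINT \<theta>|PiM {..<k} (\<lambda>_. uniform_measure lborel {0..2 * pi}). f (\<lambda>j. cis (\<theta> j)))"

end

theory Submission
  imports Defs "HOL-Complex_Analysis.Cauchy_Integral_Formula"
    "HOL-Combinatorics.Multiset_Permutations" "HOL-Probability.Infinite_Product_Measure"
begin

text \<open>
  The parts of \<open>\<lambda>\<close> are stripped off one at a time. Sort the terms of the symmetrising sum by the
  argument that stands in the first slot; what is left behind it is the same sum for the shorter
  partition and the remaining arguments (\<open>hl_sum\<close>). For this to become a recursion of integrals,
  the integral of the theorem is placed in a family of four. For \<open>Y \<subseteq> {1, -1}\<close> the arguments
  are the letters \<open>x\<^sub>i, 1/x\<^sub>i\<close> together with the elements of \<open>Y\<close>, and the weight has the pair factors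
  of the Koornwinder density and in each variable the factor
  \[ \frac{1}{1 - t x^{\pm 2}} \prod_{y \in Y} \frac{1 - y x^{\pm 1}}{1 - t y x^{\pm 1}} . \]
  For \<open>Y = {-1}\<close> this is the density of the theorem; at \<open>t = 0\<close> the four weights are the eigenvalue
  densities of the components of even and odd orthogonal groups. The factor \<open>\<Prod>(1 - \<alpha> z)\<close> over
  all letters is symmetric and is carried along unchanged.

  If the first slot holds \<open>y \<in> Y\<close>, its kernel factors against all \<open>x\<^sub>i\<close> and \<open>1/x\<^sub>i\<close> cancel exactly
  the factors that \<open>y\<close> contributes to the weight, so that the integrand for \<open>Y - {y}\<close> remains
  (\<open>hl_summand_Fix\<close>). If it holds \<open>x\<^sub>i\<close> or \<open>1/x\<^sub>i\<close>, the cancellation leaves for the two terms together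
  \[ \frac{F(u) - F(1/u)}{u - 1/u}, \qquad u = x_i, \]
  with a function \<open>F\<close> holomorphic on a disc of radius greater than 1
  (\<open>hl_summand_pair_eq_quotient\<close>). Here monotonicity of \<open>\<lambda>\<close> enters: the shorter sum is a
  polynomial in \<open>1/u\<close> of degree at most the next part, and the power \<open>u^l\<close> of the first part
  removes the pole at 0. The mean of such a quotient over the circle is \<open>(F 1 - F (-1)) / 2\<close>
  (\<open>integral_antisym_quotient\<close>): the variable \<open>x\<^sub>i\<close> gets frozen at a sign \<open>s\<close>. If \<open>s \<in> Y\<close>, then
  \<open>F s = 0\<close>; otherwise \<open>F s\<close> is a multiple of the integrand for \<open>Y \<union> {s}\<close> with one variable less.

  The resulting recursion \<open>hl_integral_Cons\<close> depends on the first part only through its parity and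
  has the solution \<open>hl_integral_eval\<close>: a constant times the sum or the difference of
  \<open>(-\<alpha>)\<close> to the number of odd parts and \<open>(-\<alpha>)\<close> to the number of even parts. The normalising integral
  is the case \<open>\<lambda> = 0\<close>, \<open>\<alpha> = 0\<close>, since for \<open>\<lambda> = 0\<close> the symmetrising sum is the constant \<open>[N]!\<close>
  (\<open>hl_sum_zero_partition\<close>).

  All identities between integrands hold where the letters are pairwise distinct, which is almost
  everywhere. Splitting the integral into the single pieces needs each piece to be integrable;
  this follows from bounds that are uniform in the remaining variables, and these come from
  polynomiality again, by interpolation through nodes off the unit circle (\<open>hl_sum_bounded\<close>).
\<close>

section \<open>The symmetrising sum over a set of letters\<close>

definition hl_kernel :: "complex \<Rightarrow> complex \<Rightarrow> complex \<Rightarrow> complex" where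
  "hl_kernel t u v = (u - t * v) / (u - v)"

text \<open>
  The recursion runs over the slots: \<open>a\<close> is the letter in the first slot. The letters form a set of
  labels with a valuation \<open>z\<close>, so that symmetry is built in and a letter can be relabelled or
  re-evaluated without touching the others.
\<close>

primrec hl_sum :: "complex \<Rightarrow> nat list \<Rightarrow> 'a set \<Rightarrow> ('a \<Rightarrow> complex) \<Rightarrow> complex" where
  "hl_sum t [] A z = 1"
| "hl_sum t (l # ls) A z =
     (\<Sum>a\<in>A. z a ^ l * (\<Prod>b\<in>A - {a}. hl_kernel t (z a) (z b)) * hl_sum t ls (A - {a}) z)"

lemma hl_sum_cong:
  assumes "\<And>a. a \<in> A \<Longrightarrow> z a = z' a"
  shows "hl_sum t ls A z = hl_sum t ls A z'"
  using assms
proof (induction ls arbitrary: A)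
  case (Cons l ls)
  have "hl_sum t ls (A - {a}) z = hl_sum t ls (A - {a}) z'" for a
    by (rule Cons.IH) (use Cons.prems in auto)
  then show ?case using Cons.prems by (auto intro!: sum.cong prod.cong arg_cong2[where f = times])
qed simp

lemma hl_sum_reindex:
  assumes "inj_on h A"
  shows "hl_sum t ls (h ` A) z = hl_sum t ls A (z \<circ> h)"
  using assms
proof (induction ls arbitrary: A)
  case (Cons l ls)
  have *: "h ` A - {h a} = h ` (A - {a})" if "a \<in> A" for a
    using that Cons.prems by (auto simp: inj_on_def)
  show ?case
    using Cons.prems by (auto simp: sum.reindex * prod.reindex inj_on_diff Cons.IH intro!: sum.cong)
qed simp

text \<open>
  The term of the symmetrising sum that belongs to one ordering of the arguments.
\<close>

fun hl_weight :: "complex \<Rightarrow> nat list \<Rightarrow> complex list \<Rightarrow> complex" where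
  "hl_weight t (l # ls) (u # us) = u ^ l * (\<Prod>v\<leftarrow>us. hl_kernel t u v) * hl_weight t ls us"
| "hl_weight t _ _ = 1"

lemma hl_sum_eq_sum_orderings:
  assumes "finite A" "length ls = card A"
  shows "hl_sum t ls A z = (\<Sum>xs\<in>permutations_of_set A. hl_weight t ls (map z xs))"
  using assms
proof (induction ls arbitrary: A)
  case (Cons l ls)
  then have ne: "A \<noteq> {}" by auto
  have "(\<Sum>xs\<in>permutations_of_set A. hl_weight t (l # ls) (map z xs)) =
    (\<Sum>a\<in>A. \<Sum>xs\<in>(#) a ` permutations_of_set (A - {a}). hl_weight t (l # ls) (map z xs))"
    unfolding permutations_of_set_nonempty[OF ne]
    by (rule sum.UNION_disjoint) (use Cons.prems in auto)
  also have "\<dots> = (\<Sum>a\<in>A. \<Sum>xs\<in>permutations_of_set (A - {a}). hl_weight t (l # ls) (z a # map z xs))"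
    by (simp add: sum.reindex)
  also have "\<dots> = (\<Sum>a\<in>A. z a ^ l * (\<Prod>b\<in>A - {a}. hl_kernel t (z a) (z b)) * hl_sum t ls (A - {a}) z)"
  proof (rule sum.cong[OF refl])
    fix a assume a: "a \<in> A"
    have *: "(\<Prod>v\<leftarrow>map z xs. hl_kernel t (z a) v) = (\<Prod>b\<in>A - {a}. hl_kernel t (z a) (z b))"
      if "xs \<in> permutations_of_set (A - {a})" for xs
      using permutations_of_setD[OF that] by (simp add: o_def flip: prod.distinct_set_conv_list)
    show "(\<Sum>xs\<in>permutations_of_set (A - {a}). hl_weight t (l # ls) (z a # map z xs)) =
      z a ^ l * (\<Prod>b\<in>A - {a}. hl_kernel t (z a) (z b)) * hl_sum t ls (A - {a}) z"
    proof -
      have IH: "hl_sum t ls (A - {a}) z = (\<Sum>xs\<in>permutations_of_set (A - {a}). hl_weight t ls (map z xs))"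
        using Cons.prems a by (intro Cons.IH) auto
      show ?thesis
        unfolding IH sum_distrib_left by (rule sum.cong[OF refl]) (simp only: hl_weight.simps *)
    qed
  qed
  finally show ?case by simp
qed simp

lemma hl_weight_eq_prod:
  assumes "length ls = length us"
  shows "hl_weight t ls us =
    (\<Prod>i<length us. us ! i ^ (ls ! i)) * (\<Prod>j<length us. \<Prod>i<j. hl_kernel t (us ! i) (us ! j))"
  using assms
proof (induction t ls us rule: hl_weight.induct)
  case (1 t l ls u us)
  have "(\<Prod>v\<leftarrow>us. hl_kernel t u v) = (\<Prod>j<length us. hl_kernel t u (us ! j))"
    by (simp add: prod.list_conv_set_nth atLeast0LessThan)
  then show ?case using 1
    by (simp add: prod.lessThan_Suc_shift prod.distrib del: prod.lessThan_Suc)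
qed auto

lemma bij_betw_permutes_permutations_of_set:
  "bij_betw (\<lambda>w. map w [0..<N]) {w. w permutes {..<N}} (permutations_of_set {..<N})"
proof -
  have inj: "inj_on (\<lambda>w. map w [0..<N]) {w. w permutes {..<N}}"
  proof (rule inj_onI)
    fix v w assume "v \<in> {w. w permutes {..<N}}" "w \<in> {w. w permutes {..<N}}"
      and eq: "map v [0..<N] = map w [0..<N]"
    moreover from eq have "v i = w i" if "i < N" for i
      using that by (auto simp: map_eq_conv)
    ultimately show "v = w" by (metis lessThan_iff mem_Collect_eq permutes_not_in ext)
  qed
  have "(\<lambda>w. map w [0..<N]) ` {w. w permutes {..<N}} \<subseteq> permutations_of_set {..<N}"
  proof (rule image_subsetI)
    fix w assume "w \<in> {w. w permutes {..<N}}"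
    then have w: "w permutes {..<N}" by simp
    have "set (map w [0..<N]) = {..<N}"
      using permutes_image[OF w] by (simp add: atLeast0LessThan)
    moreover have "distinct (map w [0..<N])"
      by (simp add: distinct_map permutes_inj_on[OF w])
    ultimately show "map w [0..<N] \<in> permutations_of_set {..<N}"
      by (rule permutations_of_setI)
  qed
  moreover have "card ((\<lambda>w. map w [0..<N]) ` {w. w permutes {..<N}}) = card (permutations_of_set {..<N})"
    using card_image[OF inj] card_permutations[of "{..<N}" N] by simp
  ultimately show ?thesis
    using inj by (simp add: bij_betw_def card_subset_eq)
qed

lemma hall_littlewood_eq_hl_sum:
  "hall_littlewood lam z t = 1 / HL_v lam t * hl_sum t lam {..<length lam} ((!) z)"
proof -
  let ?N = "length lam"
  have "hl_sum t lam {..<?N} ((!) z) =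
    (\<Sum>w | w permutes {..<?N}. hl_weight t lam (map ((!) z) (map w [0..<?N])))"
    by (simp add: hl_sum_eq_sum_orderings
        sum.reindex_bij_betw[OF bij_betw_permutes_permutations_of_set, symmetric])
  then show ?thesis
    by (simp add: hall_littlewood_def hl_weight_eq_prod hl_kernel_def)
qed

section \<open>Lagrange interpolation\<close>

lemma poly_divisible_by_root_factors:
  fixes Q :: "complex poly"
  assumes "finite A" "inj_on z A" "\<And>a. a \<in> A \<Longrightarrow> poly Q (z a) = 0"
  shows "\<exists>p. Q = p * (\<Prod>a\<in>A. [:- z a, 1:])"
  using assms
proof (induction A rule: finite_induct)
  case (insert a A)
  then obtain p where p: "Q = p * (\<Prod>b\<in>A. [:- z b, 1:])" by auto
  have "poly (\<Prod>b\<in>A. [:- z b, 1:]) (z a) \<noteq> 0"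
    using insert by (auto simp: poly_prod inj_on_def)
  then have "poly p (z a) = 0" using insert.prems(2)[of a] p by auto
  then obtain q where "p = [:- z a, 1:] * q" by (auto simp: poly_eq_0_iff_dvd elim: dvdE)
  then have "Q = q * (\<Prod>b\<in>insert a A. [:- z b, 1:])"
    using insert p by (simp add: mult_ac del: mult_pCons_left mult_pCons_right)
  then show ?case by blast
qed auto

lemma degree_prod_linear: 
  fixes z :: "'a \<Rightarrow> complex"
  shows "finite A \<Longrightarrow> degree (\<Prod>a\<in>A. [:c a, z a:]) \<le> card A"
proof (induction A rule: finite_induct)
  case (insert a A)
  have "degree ([:c a, z a:] * (\<Prod>a\<in>A. [:c a, z a:])) \<le> degree [:c a, z a:] + degree (\<Prod>a\<in>A. [:c a, z a:])"
    by (rule degree_mult_le)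
  also have "\<dots> \<le> 1 + card A" using insert by (intro add_mono) auto
  finally show ?case using insert by simp
qed simp

lemma degree_prod_monic:
  fixes z :: "'a \<Rightarrow> complex"
  shows "finite A \<Longrightarrow> degree (\<Prod>a\<in>A. [:- z a, 1:]) = card A"
  by (subst degree_prod_sum_eq) auto

lemma lagrange_interpolation:
  fixes p :: "complex poly"
  assumes A: "finite A" "inj_on z A" and deg: "degree p < card A"
  shows "poly p x = (\<Sum>a\<in>A. poly p (z a) * (\<Prod>b\<in>A - {a}. (x - z b) / (z a - z b)))"
proof -
  define q where "q = (\<Sum>a\<in>A. smult (poly p (z a)) (\<Prod>b\<in>A - {a}. [:- z b / (z a - z b), 1 / (z a - z b):]))"
  have q: "poly q y = (\<Sum>a\<in>A. poly p (z a) * (\<Prod>b\<in>A - {a}. (y - z b) / (z a - z b)))" for y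
    unfolding q_def by (simp add: poly_sum poly_prod diff_divide_distrib)
  have "degree (smult (poly p (z a)) (\<Prod>b\<in>A - {a}. [:- z b / (z a - z b), 1 / (z a - z b):])) \<le> card A - 1"
    if "a \<in> A" for a
    using degree_prod_linear[of "A - {a}" "\<lambda>b. - z b / (z a - z b)" "\<lambda>b. 1 / (z a - z b)"] A that
    by (intro order.trans[OF degree_smult_le]) auto
  then have "degree q \<le> card A - 1"
    unfolding q_def by (intro degree_sum_le) (use A in auto)
  with deg have degq: "degree q < card A" by simp
  have eq: "poly (p - q) (z c) = 0" if c: "c \<in> A" for c
  proof -
    have "(\<Prod>b\<in>A - {a}. (z c - z b) / (z a - z b)) = (if a = c then 1 else 0)" if "a \<in> A" for a
      using that c A by (auto simp: inj_on_def intro!: prod.neutral split: if_splits)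
    then have "poly q (z c) = (\<Sum>a\<in>A. if a = c then poly p (z a) else 0)"
      unfolding q by (intro sum.cong) auto
    then show ?thesis using A c by simp
  qed
  have "p - q = 0"
  proof (rule ccontr)
    assume "p - q \<noteq> 0"
    obtain r where r: "p - q = r * (\<Prod>a\<in>A. [:- z a, 1:])"
      using poly_divisible_by_root_factors[OF A eq] by blast
    with \<open>p - q \<noteq> 0\<close> have "r \<noteq> 0" by auto
    then have "degree (p - q) = degree r + card A"
      unfolding r using A by (subst degree_mult_eq) (auto simp: degree_prod_monic)
    moreover have "degree (p - q) < card A" using deg degq by (rule degree_diff_less)
    ultimately show False by simp
  qed
  then show ?thesis using q[of x] by simp
qed

section \<open>Polynomiality, boundedness and the zero partition\<close>

text \<open>
  Each term has poles where \<open>u\<close> meets another letter \<open>c\<close>, but they are simple, and the two terms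
  with \<open>u\<close> resp. \<open>c\<close> in the first slot have opposite residues because the shorter sum is symmetric.
  The degree is bounded by the largest part since the kernel stays bounded as \<open>u\<close> tends to infinity.
\<close>

lemma hl_sum_polynomial_in_variable:
  assumes "finite A" "inj_on z A" "u \<notin> A" "\<forall>l\<in>set ls. l \<le> m"
  shows "\<exists>p. degree p \<le> m \<and>
    (\<forall>v. v \<notin> z ` A \<longrightarrow> hl_sum t ls (insert u A) (z(u := v)) = poly p v)"
  using assms
proof (induction ls arbitrary: A)
  case Nil
  then show ?case by (intro exI[of _ 1]) auto
next
  case (Cons l ls)
  have "\<forall>a\<in>A. \<exists>p. degree p \<le> m \<and>
    (\<forall>v. v \<notin> z ` (A - {a}) \<longrightarrow> hl_sum t ls (insert u (A - {a})) (z(u := v)) = poly p v)"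
    by (intro ballI Cons.IH) (use Cons.prems in \<open>auto simp: inj_on_def\<close>)
  then obtain p where deg: "\<And>a. a \<in> A \<Longrightarrow> degree (p a) \<le> m"
    and p: "\<And>a v. a \<in> A \<Longrightarrow> v \<notin> z ` (A - {a}) \<Longrightarrow>
      hl_sum t ls (insert u (A - {a})) (z(u := v)) = poly (p a) v"
    by metis
  define k where "k a = (\<Prod>b\<in>A - {a}. hl_kernel t (z a) (z b))" for a
  define h0 where "h0 = hl_sum t ls A z"
  define D where "D = (\<Prod>a\<in>A. [:- z a, 1:])"
  \<comment> \<open>The sum multiplied by the common denominator \<open>D\<close>.\<close>
  define Q where "Q = smult h0 (monom 1 l * (\<Prod>b\<in>A. [:- t * z b, 1:])) +
    (\<Sum>a\<in>A. smult (- (z a ^ l * k a)) ([:z a, - t:] * p a * (\<Prod>b\<in>A - {a}. [:- z b, 1:])))"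
  have D: "poly D v = (\<Prod>b\<in>A. v - z b)" for v
    unfolding D_def by (simp add: poly_prod)
  have Q: "poly Q v = h0 * (v ^ l * (\<Prod>b\<in>A. v - t * z b)) +
      (\<Sum>a\<in>A. - (z a ^ l * k a * ((z a - t * v) * poly (p a) v * (\<Prod>b\<in>A - {a}. v - z b))))" for v
    unfolding Q_def by (simp add: poly_sum poly_prod poly_monom mult.commute[of v t] del: mult_pCons_left)
  have root: "poly Q (z c) = 0" if c: "c \<in> A" for c
  proof -
    have "(\<Prod>b\<in>A - {a}. z c - z b) = 0" if "a \<in> A" "a \<noteq> c" for a
      using that c Cons.prems by auto
    then have "(\<Sum>a\<in>A. - (z a ^ l * k a * ((z a - t * z c) * poly (p a) (z c) * (\<Prod>b\<in>A - {a}. z c - z b))))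
      = (\<Sum>a\<in>A. if a = c then - (z c ^ l * k c * ((z c - t * z c) * poly (p c) (z c) * (\<Prod>b\<in>A - {c}. z c - z b))) else 0)"
      by (intro sum.cong) auto
    also have "\<dots> = - (z c ^ l * (z c - t * z c) * poly (p c) (z c) * (k c * (\<Prod>b\<in>A - {c}. z c - z b)))"
      using c Cons.prems by simp
    also have "k c * (\<Prod>b\<in>A - {c}. z c - z b) = (\<Prod>b\<in>A - {c}. z c - t * z b)"
      unfolding k_def prod.distrib[symmetric] hl_kernel_def
      by (intro prod.cong) (use c Cons.prems in \<open>auto simp: inj_on_def\<close>)
    also have "poly (p c) (z c) = hl_sum t ls (insert u (A - {c})) (z(u := z c))"
      using c Cons.prems by (subst p) (auto simp: inj_on_def)
    \<comment> \<open>Here symmetry enters: the letter \<open>u\<close> with the value of \<open>c\<close> takes the place of \<open>c\<close>.\<close>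
    also have "insert u (A - {c}) = (id(c := u)) ` A"
      using c by auto
    also have "hl_sum t ls \<dots> (z(u := z c)) = hl_sum t ls A (z(u := z c) \<circ> id(c := u))"
      using c Cons.prems by (intro hl_sum_reindex) (auto simp: inj_on_def)
    also have "\<dots> = h0"
      unfolding h0_def using Cons.prems by (intro hl_sum_cong) auto
    finally show ?thesis
      unfolding Q using Cons.prems c by (simp add: prod.remove algebra_simps)
  qed
  obtain q where q: "Q = q * D"
    using poly_divisible_by_root_factors[of A z Q] root Cons.prems unfolding D_def by blast
  have "D \<noteq> 0" using Cons.prems by (auto simp: D_def)
  have "degree Q \<le> m + card A"
    unfolding Q_def
  proof (intro degree_add_le degree_sum_le)
    have "degree (monom 1 l * (\<Prod>b\<in>A. [:- t * z b, 1:])) \<le> degree (monom (1::complex) l) + degree (\<Prod>b\<in>A. [:- t * z b, 1:])"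
      by (rule degree_mult_le)
    also have "\<dots> \<le> m + card A"
      using Cons.prems degree_prod_linear[of A "\<lambda>b. - t * z b" "\<lambda>_. 1"] 
      by (intro add_mono) (auto intro: order.trans[OF degree_monom_le])
    finally show "degree (smult h0 (monom 1 l * (\<Prod>b\<in>A. [:- t * z b, 1:]))) \<le> m + card A"
      by (rule order.trans[OF degree_smult_le])
  next
    fix a assume a: "a \<in> A"
    have "degree ([:z a, - t:] * p a * (\<Prod>b\<in>A - {a}. [:- z b, 1:])) \<le>
      (degree [:z a, - t:] + degree (p a)) + degree (\<Prod>b\<in>A - {a}. [:- z b, 1:])"
      by (intro order.trans[OF degree_mult_le] add_mono degree_mult_le order.refl)
    also have "\<dots> \<le> (1 + m) + (card A - 1)"
      using a deg[OF a] degree_prod_linear[of "A - {a}" "\<lambda>b. - z b" "\<lambda>_. 1"] Cons.prems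
      by (intro add_mono) auto
    also have "\<dots> = m + card A" using a Cons.prems by (cases "card A") auto
    finally show "degree (smult (- (z a ^ l * k a)) ([:z a, - t:] * p a * (\<Prod>b\<in>A - {a}. [:- z b, 1:]))) \<le> m + card A"
      by (rule order.trans[OF degree_smult_le])
  qed (use Cons.prems in auto)
  moreover have "q \<noteq> 0 \<Longrightarrow> degree Q = degree q + card A"
    unfolding q using \<open>D \<noteq> 0\<close> Cons.prems by (subst degree_mult_eq) (auto simp: D_def degree_prod_monic)
  ultimately have "degree q \<le> m" by (cases "q = 0") auto
  moreover have "hl_sum t (l # ls) (insert u A) (z(u := v)) = poly q v" if v: "v \<notin> z ` A" for v
  proof -
    have ne: "poly D v \<noteq> 0" using v Cons.prems by (auto simp: D)
    have Ds: "(\<Prod>b\<in>A - {a}. v - z b) * (v - z a) = poly D v" if "a \<in> A" for a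
      using that Cons.prems by (simp add: D prod.remove)
    have first: "(\<Prod>b\<in>insert u A - {u}. hl_kernel t ((z(u := v)) u) ((z(u := v)) b)) =
      (\<Prod>b\<in>A. v - t * z b) / poly D v"
      unfolding D prod_dividef[symmetric] using Cons.prems
      by (intro prod.cong) (auto simp: hl_kernel_def)
    have h: "hl_sum t ls (insert u A - {u}) (z(u := v)) = h0"
    proof -
      have "insert u A - {u} = A" using Cons.prems by auto
      then show ?thesis
        unfolding h0_def using Cons.prems by (auto intro: hl_sum_cong)
    qed
    have "hl_sum t (l # ls) (insert u A) (z(u := v)) =
      v ^ l * ((\<Prod>b\<in>A. v - t * z b) / poly D v) * h0 +
      (\<Sum>a\<in>A. z a ^ l * (\<Prod>b\<in>insert u A - {a}. hl_kernel t (z a) ((z(u := v)) b)) *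
         hl_sum t ls (insert u A - {a}) (z(u := v)))"
    proof -
      have za: "(z(u := v)) a = z a" if "a \<in> A" for a using that Cons.prems by auto
      show ?thesis
        unfolding hl_sum.simps using Cons.prems
        by (subst sum.insert)
          (simp_all only: first[unfolded fun_upd_same] h za fun_upd_same simp_thms cong: sum.cong)
    qed
    also have "(\<Sum>a\<in>A. z a ^ l * (\<Prod>b\<in>insert u A - {a}. hl_kernel t (z a) ((z(u := v)) b)) *
         hl_sum t ls (insert u A - {a}) (z(u := v))) =
      (\<Sum>a\<in>A. - (z a ^ l * k a * ((z a - t * v) * poly (p a) v * (\<Prod>b\<in>A - {a}. v - z b)))) / poly D v"
      unfolding sum_divide_distrib
    proof (rule sum.cong[OF refl])
      fix a assume a: "a \<in> A"
      have ia: "insert u A - {a} = insert u (A - {a})" using a Cons.prems by auto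
      have "(\<Prod>b\<in>insert u A - {a}. hl_kernel t (z a) ((z(u := v)) b)) = hl_kernel t (z a) v * k a"
      proof -
        have "(\<Prod>b\<in>A - {a}. hl_kernel t (z a) ((z(u := v)) b)) = k a"
          unfolding k_def by (rule prod.cong) (use Cons.prems in auto)
        then show ?thesis
          unfolding ia using Cons.prems by (subst prod.insert) simp_all
      qed
      moreover have "hl_sum t ls (insert u A - {a}) (z(u := v)) = poly (p a) v"
        unfolding ia using a v by (intro p) auto
      moreover have "hl_kernel t (z a) v = - ((z a - t * v) * (\<Prod>b\<in>A - {a}. v - z b)) / poly D v"
        using ne v a unfolding Ds[OF a, symmetric] hl_kernel_def by (auto simp: divide_simps) (auto simp: algebra_simps)
      ultimately show "z a ^ l * (\<Prod>b\<in>insert u A - {a}. hl_kernel t (z a) ((z(u := v)) b)) *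
         hl_sum t ls (insert u A - {a}) (z(u := v)) =
         - (z a ^ l * k a * ((z a - t * v) * poly (p a) v * (\<Prod>b\<in>A - {a}. v - z b))) / poly D v"
        by simp
    qed
    also have "v ^ l * ((\<Prod>b\<in>A. v - t * z b) / poly D v) * h0 + \<dots> = poly Q v / poly D v"
      unfolding Q by (simp add: add_divide_distrib mult_ac)
    also have "\<dots> = poly q v" using ne by (simp add: q)
    finally show ?thesis .
  qed
  ultimately show ?case by blast
qed


text \<open>
  The terms of the sum are unbounded near coinciding letters, so the bound has to come from
  polynomiality: letters on the unit circle are replaced one by one, by Lagrange interpolation, by
  fixed nodes of absolute value greater than 1. Such nodes cannot collide with letters on the
  circle, and avoiding the nodes already chosen keeps all letters distinct. Once every letter is a
  node, there is only one value left to bound.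
\<close>

lemma hl_sum_bounded:
  assumes "finite B" "finite C" "B \<inter> C = {}" "inj_on w C" "\<forall>c\<in>C. norm (w c) > 1"
  shows "\<exists>M. \<forall>z. inj_on z B \<longrightarrow> (\<forall>b\<in>B. norm (z b) = 1) \<longrightarrow> (\<forall>c\<in>C. z c = w c) \<longrightarrow>
    norm (hl_sum t ls (B \<union> C) z) \<le> M"
  using assms
proof (induction B arbitrary: C w rule: finite_induct)
  case empty
  show ?case
  proof (intro exI allI impI)
    fix z assume "\<forall>c\<in>C. z c = w c"
    then have "hl_sum t ls ({} \<union> C) z = hl_sum t ls C w"
      by (auto intro: hl_sum_cong)
    then show "norm (hl_sum t ls ({} \<union> C) z) \<le> norm (hl_sum t ls C w)" by simp
  qed
next
  case (insert b B)
  define m where "m = sum_list ls"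
  have m: "\<forall>l\<in>set ls. l \<le> m"
    unfolding m_def using member_le_sum_list by blast
  \<comment> \<open>The integers from 2 on serve as a supply of nodes off the unit circle.\<close>
  have "infinite (range (\<lambda>n::nat. complex_of_nat (n + 2)))"
    by (intro range_inj_infinite) (auto simp: inj_on_def)
  then have "infinite (range (\<lambda>n::nat. complex_of_nat (n + 2)) - w ` C)"
    using insert.prems by (intro Diff_infinite_finite) auto
  then obtain V where V: "finite V" "card V = Suc m"
    "V \<subseteq> range (\<lambda>n::nat. complex_of_nat (n + 2)) - w ` C"
    using infinite_arbitrarily_large by blast
  have normV: "norm v > 1" if v: "v \<in> V" for v
  proof -
    obtain n :: nat where "v = complex_of_nat (n + 2)" using v V by auto
    then show ?thesis by (simp only: norm_of_nat)
  qed
  have "\<forall>v\<in>V. \<exists>M. \<forall>z. inj_on z B \<longrightarrow> (\<forall>b\<in>B. norm (z b) = 1) \<longrightarrow>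
      (\<forall>c\<in>insert b C. z c = (w(b := v)) c) \<longrightarrow> norm (hl_sum t ls (B \<union> insert b C) z) \<le> M"
  proof (rule ballI, rule insert.IH)
    fix v assume v: "v \<in> V"
    show "finite (insert b C)" using insert.prems by simp
    show "B \<inter> insert b C = {}" using insert by auto
    show "inj_on (w(b := v)) (insert b C)"
      using insert.prems v V by (auto simp: inj_on_def)
    show "\<forall>c\<in>insert b C. norm ((w(b := v)) c) > 1"
      using insert.prems normV[OF v] by auto
  qed
  then obtain M where M: "\<And>v z. v \<in> V \<Longrightarrow> inj_on z B \<Longrightarrow> (\<forall>b\<in>B. norm (z b) = 1) \<Longrightarrow>
      (\<forall>c\<in>insert b C. z c = (w(b := v)) c) \<Longrightarrow> norm (hl_sum t ls (B \<union> insert b C) z) \<le> M v"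
    by metis
  show ?case
  proof (intro exI allI impI)
    fix z assume inj: "inj_on z (insert b B)" and one: "\<forall>b\<in>insert b B. norm (z b) = 1"
      and zC: "\<forall>c\<in>C. z c = w c"
    have injBC: "inj_on z (B \<union> C)"
    proof (rule inj_onI)
      fix x y assume *: "x \<in> B \<union> C" "y \<in> B \<union> C" "z x = z y"
      consider "x \<in> B" "y \<in> B" | "x \<in> C" "y \<in> C" | "x \<in> B" "y \<in> C" | "x \<in> C" "y \<in> B"
        using * by blast
      then show "x = y"
      proof cases
        case 1 then show ?thesis using inj * by (auto simp: inj_on_def)
      next
        case 2 then show ?thesis using insert.prems zC * by (auto simp: inj_on_def)
      next
        case 3 then show ?thesis using insert.prems zC one * by (metis insertCI less_irrefl)
      next
        case 4 then show ?thesis using insert.prems zC one * by (metis insertCI less_irrefl)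
      qed
    qed
    have b: "b \<notin> B \<union> C" using insert by auto
    have zb: "z b \<notin> z ` (B \<union> C)"
    proof
      assume "z b \<in> z ` (B \<union> C)"
      then obtain c where c: "c \<in> B \<union> C" "z b = z c" by auto
      show False
      proof (cases "c \<in> B")
        case True then show ?thesis using c inj insert.hyps by (auto simp: inj_on_def)
      next
        case False then show ?thesis using c insert.prems zC one by (metis UnE insertCI less_irrefl)
      qed
    qed
    obtain p where p: "degree p \<le> m"
      "\<And>v. v \<notin> z ` (B \<union> C) \<Longrightarrow> hl_sum t ls (insert b (B \<union> C)) (z(b := v)) = poly p v"
      using hl_sum_polynomial_in_variable[of "B \<union> C" z b ls m t] injBC b m insert by auto
    have pv: "norm (poly p v) \<le> M v" if v: "v \<in> V" for v
    proof -
      have "v \<notin> z ` (B \<union> C)"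
      proof
        assume "v \<in> z ` (B \<union> C)"
        then obtain c where c: "c \<in> B \<union> C" "v = z c" by auto
        show False
        proof (cases "c \<in> B")
          case True then show ?thesis using c one normV[OF v] by auto
        next
          case False then show ?thesis using c zC v V by auto
        qed
      qed
      then have "poly p v = hl_sum t ls (B \<union> insert b C) (z(b := v))"
        using p(2)[of v] by simp
      also have "norm \<dots> \<le> M v"
        using inj one zC insert v by (intro M) (auto simp: inj_on_def)
      finally show ?thesis .
    qed
    have "hl_sum t ls (insert b B \<union> C) z = poly p (z b)"
      using p(2)[OF zb] by (simp add: fun_upd_triv)
    also have "\<dots> = (\<Sum>v\<in>V. poly p (id v) * (\<Prod>a\<in>V - {v}. (z b - id a) / (id v - id a)))"
      using V p(1) by (intro lagrange_interpolation) auto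
    also have "norm \<dots> \<le> (\<Sum>v\<in>V. M v * (\<Prod>a\<in>V - {v}. (1 + norm a) / norm (v - a)))"
    proof (rule sum_norm_le)
      fix v assume v: "v \<in> V"
      have "norm (\<Prod>a\<in>V - {v}. (z b - id a) / (id v - id a)) \<le> (\<Prod>a\<in>V - {v}. (1 + norm a) / norm (v - a))"
        unfolding prod_norm[symmetric]
      proof (rule prod_mono)
        fix a assume "a \<in> V - {v}"
        have "norm (z b - a) \<le> 1 + norm a" using one norm_triangle_ineq4[of "z b" a] by auto
        then show "0 \<le> norm ((z b - id a) / (id v - id a)) \<and>
          norm ((z b - id a) / (id v - id a)) \<le> (1 + norm a) / norm (v - a)"
          by (auto simp: norm_divide intro: divide_right_mono)
      qed
      then show "norm (poly p (id v) * (\<Prod>a\<in>V - {v}. (z b - id a) / (id v - id a)))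
        \<le> M v * (\<Prod>a\<in>V - {v}. (1 + norm a) / norm (v - a))"
        unfolding norm_mult using pv[OF v] order.trans[OF norm_ge_zero pv[OF v]]
        by (intro mult_mono) auto
    qed
    finally show "norm (hl_sum t ls (insert b B \<union> C) z) \<le>
      (\<Sum>v\<in>V. M v * (\<Prod>a\<in>V - {v}. (1 + norm a) / norm (v - a)))" .
  qed
qed

text \<open>
  Lagrange interpolation of \<open>\<Prod>(X - t z\<^sub>b) - \<Prod>(X - z\<^sub>b)\<close>, a polynomial of degree less than the number
  of nodes \<open>z\<^sub>b\<close>, evaluated at \<open>X = 0\<close>.
\<close>

lemma sum_prod_hl_kernel:
  assumes A: "finite A" "A \<noteq> {}" "inj_on z A" "\<forall>a\<in>A. z a \<noteq> 0" and t: "t \<noteq> 1"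
  shows "(\<Sum>a\<in>A. \<Prod>b\<in>A - {a}. hl_kernel t (z a) (z b)) = t_int t (card A)"
proof -
  define P where "P s = (\<Prod>b\<in>A. [:- (s * z b), 1:])" for s
  define p where "p = P t - P 1"
  have P: "degree (P s) = card A" "lead_coeff (P s) = 1" for s
    unfolding P_def lead_coeff_prod using A by (simp_all add: degree_prod_monic)
  have "degree p < card A"
  proof (rule ccontr)
    assume neg: "\<not> degree p < card A"
    moreover have "degree p \<le> card A" unfolding p_def by (rule degree_diff_le) (simp_all add: P)
    ultimately have eq: "degree p = card A" by simp
    have "lead_coeff p = 0"
      using P(2)[of t] P(2)[of 1] unfolding eq by (simp add: p_def P(1))
    then have "degree p = 0" by simp
    then show False using eq A by simp
  qed
  from lagrange_interpolation[OF A(1,3) this, of 0]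
  have "poly p 0 = (\<Sum>a\<in>A. poly p (z a) * (\<Prod>b\<in>A - {a}. (0 - z b) / (z a - z b)))" .
  also have "\<dots> = (\<Sum>a\<in>A. - (1 - t) * (\<Prod>b\<in>A. - z b) * (\<Prod>b\<in>A - {a}. hl_kernel t (z a) (z b)))"
  proof (rule sum.cong[OF refl])
    fix a assume a: "a \<in> A"
    have "(\<Prod>b\<in>A. z a - z b) = 0" using A a by auto
    then have "poly p (z a) = (1 - t) * z a * (\<Prod>b\<in>A - {a}. z a - t * z b)"
      using A a by (simp add: p_def P_def poly_prod prod.remove algebra_simps)
    moreover have "(\<Prod>b\<in>A. - z b) = - z a * (\<Prod>b\<in>A - {a}. - z b)"
      using A a by (simp add: prod.remove)
    moreover have "(\<Prod>b\<in>A - {a}. z a - t * z b) * (\<Prod>b\<in>A - {a}. (0 - z b) / (z a - z b)) =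
      (\<Prod>b\<in>A - {a}. - z b) * (\<Prod>b\<in>A - {a}. hl_kernel t (z a) (z b))"
      unfolding prod.distrib[symmetric] by (intro prod.cong) (auto simp: hl_kernel_def)
    ultimately show "poly p (z a) * (\<Prod>b\<in>A - {a}. (0 - z b) / (z a - z b)) =
       - (1 - t) * (\<Prod>b\<in>A. - z b) * (\<Prod>b\<in>A - {a}. hl_kernel t (z a) (z b))"
      by algebra
  qed
  also have "\<dots> = (\<Prod>b\<in>A. - z b) * (- (1 - t) * (\<Sum>a\<in>A. \<Prod>b\<in>A - {a}. hl_kernel t (z a) (z b)))"
    by (simp add: sum_distrib_left mult_ac)
  also have "poly p 0 = (\<Prod>b\<in>A. - z b) * (t ^ card A - 1)"
  proof -
    have "(\<Prod>b\<in>A. - (t * z b)) = t ^ card A * (\<Prod>b\<in>A. - z b)"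
      by (simp add: prod.distrib[symmetric] flip: prod_constant)
    then show ?thesis by (simp add: p_def P_def poly_prod algebra_simps)
  qed
  finally have "t ^ card A - 1 = - (1 - t) * (\<Sum>a\<in>A. \<Prod>b\<in>A - {a}. hl_kernel t (z a) (z b))"
    using A by simp
  then show ?thesis using t by (simp add: t_int_def field_simps)
qed

lemma hl_sum_zero_partition:
  assumes "finite A" "card A = N" "inj_on z A" "\<forall>a\<in>A. z a \<noteq> 0" "t \<noteq> 1"
  shows "hl_sum t (replicate N 0) A z = t_fact t N"
  using assms
proof (induction N arbitrary: A)
  case (Suc N)
  have "hl_sum t (replicate N 0) (A - {a}) z = t_fact t N" if "a \<in> A" for a
    using Suc.prems that by (intro Suc.IH) (auto simp: inj_on_diff)
  then have "hl_sum t (replicate (Suc N) 0) A z =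
    (\<Sum>a\<in>A. \<Prod>b\<in>A - {a}. hl_kernel t (z a) (z b)) * t_fact t N"
    by (simp add: sum_distrib_right cong: sum.cong)
  also have "\<dots> = t_int t (Suc N) * t_fact t N"
    using Suc.prems by (subst sum_prod_hl_kernel) auto
  finally show ?case by (simp add: t_fact_def)
qed (simp add: t_fact_def)

text \<open>
  Values at fixed nodes off the unit circle are what \<open>hl_sum_bounded\<close> controls; interpolation turns
  such a bound into one for the coefficients, uniformly over all polynomials of bounded degree.
\<close>

lemma lagrange_coeff_bound:
  fixes V :: "complex set"
  assumes V: "finite V" "card V = Suc m"
  shows "\<exists>K. \<forall>p :: complex poly. \<forall>B. degree p \<le> m \<longrightarrow> (\<forall>v\<in>V. norm (poly p v) \<le> B) \<longrightarrow>
    (\<forall>k. norm (coeff p k) \<le> B * K)"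
proof -
  define L where "L v = (\<Prod>b\<in>V - {v}. [:- b / (v - b), 1 / (v - b):])" for v
  define K where "K = (\<Sum>v\<in>V. \<Sum>k\<le>m. norm (coeff (L v) k))"
  show ?thesis
  proof (intro exI allI impI)
    fix p :: "complex poly" and B k
    assume deg: "degree p \<le> m" and B: "\<forall>v\<in>V. norm (poly p v) \<le> B"
    obtain v0 where "v0 \<in> V" using V by fastforce
    then have "B \<ge> 0" using B norm_ge_zero order.trans by blast
    have K0: "K \<ge> 0" unfolding K_def by (intro sum_nonneg) auto
    have "poly p x = poly (\<Sum>v\<in>V. smult (poly p v) (L v)) x" for x
      using lagrange_interpolation[of V id p x] V deg
      by (simp add: poly_sum L_def poly_prod diff_divide_distrib)
    then have p: "p = (\<Sum>v\<in>V. smult (poly p v) (L v))"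
      by (intro poly_eqI_degree[of UNIV] iffD1[OF poly_eq_poly_eq_iff] ext)
    show "norm (coeff p k) \<le> B * K"
    proof (cases "k \<le> m")
      case True
      have "coeff p k = (\<Sum>v\<in>V. poly p v * coeff (L v) k)"
        by (subst p) (simp add: coeff_sum)
      also have "norm \<dots> \<le> (\<Sum>v\<in>V. B * (\<Sum>k\<le>m. norm (coeff (L v) k)))"
      proof (rule sum_norm_le)
        fix v assume v: "v \<in> V"
        have "norm (coeff (L v) k) \<le> (\<Sum>k\<le>m. norm (coeff (L v) k))"
          by (rule member_le_sum) (use True in auto)
        then show "norm (poly p v * coeff (L v) k) \<le> B * (\<Sum>k\<le>m. norm (coeff (L v) k))"
          unfolding norm_mult using B v \<open>B \<ge> 0\<close> by (intro mult_mono) auto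
      qed
      finally show ?thesis by (simp add: K_def sum_distrib_left)
    next
      case False
      then show ?thesis using deg \<open>B \<ge> 0\<close> K0 by (simp add: coeff_eq_0)
    qed
  qed
qed

text \<open>
  The coefficients of the polynomial in \<open>b\<close> stay bounded while the other letters move on the circle.
  This is what bounds the holomorphic functions of the recursion uniformly in the other variables.
\<close>

lemma hl_sum_polynomial_bounded:
  fixes b :: 'a
  assumes B: "finite B" "b \<notin> B" and m: "\<forall>l\<in>set ls. l \<le> m"
  shows "\<exists>M. \<forall>z. inj_on z B \<longrightarrow> (\<forall>a\<in>B. norm (z a) = 1) \<longrightarrow>
    (\<exists>p. degree p \<le> m \<and>
      (\<forall>v. v \<notin> z ` B \<longrightarrow> hl_sum t ls (insert b B) (z(b := v)) = poly p v) \<and>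
      (\<forall>k. norm (coeff p k) \<le> M))"
proof -
  define V where "V = (\<lambda>n. complex_of_nat (n + 2)) ` {..m}"
  have V: "finite V" "card V = Suc m"
    unfolding V_def by (auto simp: card_image inj_on_def)
  have normV: "norm v > 1" if v: "v \<in> V" for v
  proof -
    obtain n :: nat where "v = complex_of_nat (n + 2)" using v unfolding V_def by auto
    then show ?thesis by (simp only: norm_of_nat)
  qed
  have "\<forall>v\<in>V. \<exists>M. \<forall>z. inj_on z B \<longrightarrow> (\<forall>a\<in>B. norm (z a) = 1) \<longrightarrow> (\<forall>c\<in>{b}. z c = v) \<longrightarrow>
      norm (hl_sum t ls (B \<union> {b}) z) \<le> M"
    by (rule ballI, rule hl_sum_bounded[where w = "\<lambda>_. v" for v]) (use B normV in auto)
  then obtain M where M: "\<And>v z. v \<in> V \<Longrightarrow> inj_on z B \<Longrightarrow> (\<forall>a\<in>B. norm (z a) = 1) \<Longrightarrow> z b = v \<Longrightarrow>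
      norm (hl_sum t ls (B \<union> {b}) z) \<le> M v"
    by (metis singletonD)
  define M' where "M' = (\<Sum>v\<in>V. \<bar>M v\<bar>)"
  obtain K where K: "\<And>p B. degree p \<le> m \<Longrightarrow> (\<forall>v\<in>V. norm (poly p v) \<le> B) \<Longrightarrow>
    (\<forall>k. norm (coeff p k) \<le> B * K)"
    using lagrange_coeff_bound[OF V] by blast
  show ?thesis
  proof (rule exI[of _ "M' * K"], intro allI impI)
    fix z :: "'a \<Rightarrow> complex" assume inj: "inj_on z B" and one: "\<forall>a\<in>B. norm (z a) = 1"
    obtain p where p: "degree p \<le> m"
      "\<And>v. v \<notin> z ` B \<Longrightarrow> hl_sum t ls (insert b B) (z(b := v)) = poly p v"
      using hl_sum_polynomial_in_variable[of B z b ls m t] inj m B by auto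
    have "norm (poly p v) \<le> M'" if v: "v \<in> V" for v
    proof -
      have "v \<notin> z ` B" using normV[OF v] one by auto
      then have "poly p v = hl_sum t ls (B \<union> {b}) (z(b := v))" using p(2)[of v] by simp
      also have "norm \<dots> \<le> M v"
        using B inj one by (intro M v) (auto simp: inj_on_def)
      also have "\<dots> \<le> \<bar>M v\<bar>" by simp
      also have "\<dots> \<le> M'" unfolding M'_def by (rule member_le_sum) (use v V in auto)
      finally show ?thesis .
    qed
    then show "\<exists>p. degree p \<le> m \<and>
      (\<forall>v. v \<notin> z ` B \<longrightarrow> hl_sum t ls (insert b B) (z(b := v)) = poly p v) \<and>
      (\<forall>k. norm (coeff p k) \<le> M' * K)"
      using p K[of p M'] by blast
  qed
qed

section \<open>Means over the unit circle\<close>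

definition circle_measure :: "real measure" where
  "circle_measure = uniform_measure lborel {0..2 * pi}"

lemma prob_space_circle_measure: "prob_space circle_measure"
  unfolding circle_measure_def by (intro prob_space_uniform_measure) auto

lemma sets_circle_measure [simp, measurable_cong]: "sets circle_measure = sets borel"
  by (simp add: circle_measure_def)

lemma space_circle_measure [simp]: "space circle_measure = UNIV"
  by (simp add: circle_measure_def)

lemma circle_measure_eq_density:
  "circle_measure = density lborel (\<lambda>\<theta>. ennreal (indicator {0..2 * pi} \<theta> / (2 * pi)))"
  unfolding circle_measure_def uniform_measure_def
  by (intro density_cong)
    (use divide_ennreal[of 1 "2 * pi"] in \<open>auto split: split_indicator\<close>)

lemma AE_circle_measure_notin_finite:
  assumes "finite S"
  shows "AE \<theta> in circle_measure. cis \<theta> \<notin> S"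
proof -
  have "countable {\<theta>. cis \<theta> = c}" for c
  proof (cases "\<exists>x. cis x = c")
    case True
    then obtain x where x: "cis x = c" by blast
    have "{\<theta>. cis \<theta> = c} \<subseteq> range (\<lambda>n::int. x + 2 * pi * n)"
    proof
      fix \<theta> assume "\<theta> \<in> {\<theta>. cis \<theta> = c}"
      then have "sin \<theta> = sin x \<and> cos \<theta> = cos x" using x by (auto simp: complex_eq_iff)
      then show "\<theta> \<in> range (\<lambda>n::int. x + 2 * pi * n)" unfolding sin_cos_eq_iff by auto
    qed
    then show ?thesis by (rule countable_subset) simp
  qed auto
  then have "countable (\<Union>c\<in>S. {\<theta>. cis \<theta> = c})"
    by (intro countable_UN[OF countable_finite[OF assms]])
  then have "AE \<theta> in lborel. \<theta> \<notin> (\<Union>c\<in>S. {\<theta>. cis \<theta> = c})"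
    by (intro AE_not_in countable_imp_null_set_lborel)
  then show ?thesis
    unfolding circle_measure_def by (intro AE_uniform_measureI) auto
qed

lemma measurable_cis [measurable]: "cis \<in> borel_measurable borel"
  by (intro borel_measurable_continuous_onI continuous_intros)

lemma integral_cis_multiple:
  "(LINT \<theta>|circle_measure. cis (of_int k * \<theta>)) = (if k = 0 then 1 else 0)"
proof (cases "k = 0")
  case True
  interpret prob_space circle_measure by (rule prob_space_circle_measure)
  show ?thesis using True prob_space by simp
next
  case False
  define G where "G \<theta> = cis (of_int k * \<theta>) / (\<i> * of_int k)" for \<theta>
  have "(LINT \<theta>|circle_measure. cis (of_int k * \<theta>)) =
    (LINT \<theta>|lborel. (indicator {0..2 * pi} \<theta> / (2 * pi)) *\<^sub>R cis (of_int k * \<theta>))"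
    unfolding circle_measure_eq_density
    by (rule integral_density) auto
  also have "\<dots> = (LINT \<theta>|lborel. (1 / (2 * pi)) *\<^sub>R (indicator {0..2 * pi} \<theta> *\<^sub>R cis (of_int k * \<theta>)))"
    by (rule Bochner_Integration.integral_cong[OF refl]) (simp only: scaleR_scaleR divide_inverse mult.commute mult_1_left)
  also have "\<dots> = (1 / (2 * pi)) *\<^sub>R (LINT \<theta>|lborel. indicator {0..2 * pi} \<theta> *\<^sub>R cis (of_int k * \<theta>))"
    by (rule integral_scaleR_right) 
  also have "(LINT \<theta>|lborel. indicator {0..2 * pi} \<theta> *\<^sub>R cis (of_int k * \<theta>)) = G (2 * pi) - G 0"
  proof (rule integral_FTC_Icc)
    show "(G has_vector_derivative cis (of_int k * \<theta>)) (at \<theta> within {0..2 * pi})" for \<theta>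
      unfolding G_def cis_conv_exp using False
      by (auto intro!: derivative_eq_intros has_vector_derivative_real_field simp: field_simps)
    show "continuous_on {0..2 * pi} (\<lambda>\<theta>. cis (of_int k * \<theta>))"
      by (intro continuous_intros)
  qed simp
  also have "G (2 * pi) = G 0"
  proof -
    have "cis (of_int k * (2 * pi)) = 1"
      unfolding mult.commute[of "of_int k"] by (intro cis_multiple_2pi) simp
    then show ?thesis by (simp add: G_def)
  qed
  finally show ?thesis using False by simp
qed

text \<open>The function \<open>(u^k - u^{-k}) / (u - u^{-1})\<close> as a Laurent polynomial.\<close>

definition dirichlet_sum :: "nat \<Rightarrow> complex \<Rightarrow> complex" where
  "dirichlet_sum k u = (\<Sum>i<k. inverse u ^ (k - Suc i) * u ^ i)"

lemma power_minus_inverse_power: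
  "u ^ k - inverse u ^ k = (u - inverse u) * dirichlet_sum k u"
  unfolding dirichlet_sum_def by (rule power_diff_sumr2)

lemma norm_dirichlet_sum: "norm u = 1 \<Longrightarrow> norm (dirichlet_sum k u) \<le> k"
  unfolding dirichlet_sum_def
  by (rule order.trans[OF norm_sum]) (simp add: norm_mult norm_power norm_inverse)

lemma dirichlet_sum_cis:
  "dirichlet_sum k (cis \<theta>) = (\<Sum>i<k. cis (of_int (2 * int i + 1 - int k) * \<theta>))"
  unfolding dirichlet_sum_def
proof (rule sum.cong[OF refl])
  fix i assume "i \<in> {..<k}"
  then have k: "real (k - Suc i) = real k - 1 - real i" by auto
  have "inverse (cis \<theta>) ^ (k - Suc i) = cis (real (k - Suc i) * - \<theta>)"
    by (simp only: cis_inverse Complex.DeMoivre)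
  then have "inverse (cis \<theta>) ^ (k - Suc i) * cis \<theta> ^ i = cis (real (k - Suc i) * - \<theta> + real i * \<theta>)"
    by (simp only: Complex.DeMoivre cis_mult)
  also have "real (k - Suc i) * - \<theta> + real i * \<theta> = of_int (2 * int i + 1 - int k) * \<theta>"
    by (simp add: k algebra_simps)
  finally show "inverse (cis \<theta>) ^ (k - Suc i) * cis \<theta> ^ i = cis (of_int (2 * int i + 1 - int k) * \<theta>)" .
qed

lemma integral_dirichlet_sum:
  "(LINT \<theta>|circle_measure. dirichlet_sum k (cis \<theta>)) = (if odd k then 1 else 0)"
proof -
  interpret prob_space circle_measure by (rule prob_space_circle_measure)
  have int: "integrable circle_measure (\<lambda>\<theta>. cis (of_int j * \<theta>))" for j
    by (intro integrable_const_bound[where B = 1]) auto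
  have "(LINT \<theta>|circle_measure. dirichlet_sum k (cis \<theta>)) = 
    (\<Sum>i<k. LINT \<theta>|circle_measure. cis (of_int (2 * int i + 1 - int k) * \<theta>))"
    unfolding dirichlet_sum_cis by (intro Bochner_Integration.integral_sum int)
  also have "\<dots> = (\<Sum>i<k. if 2 * i + 1 = k then 1 else 0)"
    unfolding integral_cis_multiple by (intro sum.cong) auto
  also have "\<dots> = (if odd k then 1 else 0)"
  proof (cases "odd k")
    case True
    then obtain j where "k = 2 * j + 1" by (auto elim: oddE)
    then show ?thesis by simp
  next
    case False
    then show ?thesis by (auto intro!: sum.neutral)
  qed
  finally show ?thesis .
qed

text \<open>
  For \<open>F u = u^k\<close> this is \<open>dirichlet_sum k\<close>, a Laurent polynomial whose constant term is 1 for odd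
  \<open>k\<close> and 0 for even \<open>k\<close>. The mean for general \<open>F\<close> is obtained from its power series.
\<close>

definition antisym_quotient :: "(complex \<Rightarrow> complex) \<Rightarrow> complex \<Rightarrow> complex" where
  "antisym_quotient F u = (F u - F (inverse u)) / (u - inverse u)"

text \<open>
  The factor relating a bound for \<open>F\<close> on the disc of radius \<open>\<rho>\<close> to a bound for its quotient: the
  coefficient of \<open>u^k\<close> is controlled by the Cauchy estimate and \<open>dirichlet_sum k\<close> by \<open>k\<close>. It does
  not depend on \<open>F\<close>, which makes the bound uniform over a family of functions.
\<close>

definition quotient_bound :: "real \<Rightarrow> real" where
  "quotient_bound \<rho> = (\<Sum>k. real k / \<rho> ^ k)"

lemma circle_neq_inverse: "norm u = 1 \<Longrightarrow> u \<noteq> 1 \<Longrightarrow> u \<noteq> -1 \<Longrightarrow> u \<noteq> inverse (u::complex)"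
proof
  assume u: "norm u = 1" "u \<noteq> 1" "u \<noteq> -1" "u = inverse u"
  then have "u * u = 1" by (metis left_inverse norm_zero zero_neq_one)
  then have "(u - 1) * (u + 1) = 0" by (simp add: algebra_simps)
  then show False using u by (auto simp: eq_neg_iff_add_eq_0)
qed

context
  fixes F :: "complex \<Rightarrow> complex" and \<rho> M :: real
  assumes hol: "F holomorphic_on ball 0 \<rho>" and cont: "continuous_on (cball 0 \<rho>) F"
    and \<rho>: "\<rho> > 1" and bound: "\<And>u. norm u \<le> \<rho> \<Longrightarrow> norm (F u) \<le> M"
begin

private definition coef :: "nat \<Rightarrow> complex" where
  "coef k = (deriv ^^ k) F 0 / fact k"

private lemma coef_sums: "norm u = 1 \<Longrightarrow> (\<lambda>k. coef k * u ^ k) sums F u"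
  using holomorphic_power_series[OF hol, of u] \<rho> by (simp add: coef_def)

private lemma norm_coef: "norm (coef k) \<le> M / \<rho> ^ k"
proof -
  have "norm ((deriv ^^ k) F 0) \<le> fact k * M / \<rho> ^ k"
    by (rule Cauchy_inequality[OF hol cont]) (use \<rho> bound in auto)
  then show ?thesis by (simp add: coef_def norm_divide field_simps)
qed

private lemma summable_weights: "summable (\<lambda>k. real k / \<rho> ^ k)"
proof -
  have "summable (\<lambda>k. real (Suc k) * (1 / \<rho>) ^ k)"
    using geometric_deriv_sums[of "1 / \<rho>"] \<rho> by (simp add: sums_iff)
  then show ?thesis
    by (rule summable_comparison_test'[where N = 0])
      (use \<rho> in \<open>simp add: power_one_over divide_simps\<close>)
qed

private lemma term_bound:
  assumes "norm u = 1"
  shows "norm (coef k * dirichlet_sum k u) \<le> M * (real k / \<rho> ^ k)"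
proof -
  have "norm (coef k * dirichlet_sum k u) \<le> (M / \<rho> ^ k) * real k"
    unfolding norm_mult using norm_coef[of k] assms
    by (intro mult_mono norm_dirichlet_sum order.trans[OF norm_ge_zero norm_coef]) auto
  then show ?thesis by simp
qed

private lemma summable_terms:
  assumes "norm u = 1"
  shows "summable (\<lambda>k. norm (coef k * dirichlet_sum k u))"
proof (rule summable_comparison_test')
  show "summable (\<lambda>k. M * (real k / \<rho> ^ k))" by (rule summable_mult[OF summable_weights])
  show "norm (norm (coef k * dirichlet_sum k u)) \<le> M * (real k / \<rho> ^ k)" for k
    using term_bound[OF assms] by simp
qed

private lemma antisym_quotient_series:
  assumes u: "norm u = 1" "u \<noteq> 1" "u \<noteq> -1"
  shows "antisym_quotient F u = (\<Sum>k. coef k * dirichlet_sum k u)"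
proof -
  have ne: "u - inverse u \<noteq> 0" using circle_neq_inverse[OF u] by simp
  have "(\<lambda>k. coef k * u ^ k - coef k * inverse u ^ k) sums (F u - F (inverse u))"
    by (intro sums_diff coef_sums) (use u in \<open>auto simp: norm_inverse\<close>)
  then have "(\<lambda>k. (coef k * u ^ k - coef k * inverse u ^ k) / (u - inverse u)) sums antisym_quotient F u"
    unfolding antisym_quotient_def by (rule sums_divide)
  also have "(\<lambda>k. (coef k * u ^ k - coef k * inverse u ^ k) / (u - inverse u)) =
    (\<lambda>k. coef k * dirichlet_sum k u)"
    unfolding right_diff_distrib[symmetric] power_minus_inverse_power using ne by simp
  finally show ?thesis by (rule sums_unique)
qed

lemma antisym_quotient_bound:
  assumes u: "norm u = 1" "u \<noteq> 1" "u \<noteq> -1"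
  shows "norm (antisym_quotient F u) \<le> M * quotient_bound \<rho>"
proof -
  have "norm (antisym_quotient F u) \<le> (\<Sum>k. norm (coef k * dirichlet_sum k u))"
    unfolding antisym_quotient_series[OF u] by (rule summable_norm[OF summable_terms[OF u(1)]])
  also have "\<dots> \<le> (\<Sum>k. M * (real k / \<rho> ^ k))"
    by (intro suminf_le summable_terms summable_mult summable_weights term_bound u)
  also have "\<dots> = M * quotient_bound \<rho>"
    unfolding quotient_bound_def by (rule suminf_mult[OF summable_weights])
  finally show ?thesis .
qed

lemma measurable_antisym_quotient:
  "(\<lambda>\<theta>. antisym_quotient F (cis \<theta>)) \<in> borel_measurable circle_measure"
proof -
  have "F \<in> borel_measurable (restrict_space borel (cball 0 \<rho>))"
    using cont by (rule borel_measurable_continuous_on_restrict)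
  then have "(\<lambda>\<theta>. F (cis (c * \<theta>))) \<in> borel_measurable circle_measure" for c
    by (rule measurable_compose[rotated]) (use \<rho> in \<open>auto intro!: measurable_restrict_space2\<close>)
  from this[of 1] this[of "-1"] show ?thesis
    unfolding antisym_quotient_def by auto
qed

text \<open>
  Integrating term by term keeps the coefficients of odd index, and these add up to the odd part
  of \<open>F\<close> at 1.
\<close>

lemma integral_antisym_quotient:
  "(LINT \<theta>|circle_measure. antisym_quotient F (cis \<theta>)) = (F 1 - F (-1)) / 2"
proof -
  interpret prob_space circle_measure by (rule prob_space_circle_measure)
  have meas: "(\<lambda>\<theta>. dirichlet_sum k (cis \<theta>)) \<in> borel_measurable circle_measure" for k
    unfolding dirichlet_sum_def by measurable
  have int: "integrable circle_measure (\<lambda>\<theta>. coef k * dirichlet_sum k (cis \<theta>))" for k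
    using term_bound by (intro integrable_const_bound[where B = "M * (real k / \<rho> ^ k)"])
      (auto intro!: borel_measurable_times meas)
  have le: "(LINT \<theta>|circle_measure. norm (coef k * dirichlet_sum k (cis \<theta>))) \<le> M * (real k / \<rho> ^ k)" for k
  proof -
    have "(LINT \<theta>|circle_measure. norm (coef k * dirichlet_sum k (cis \<theta>))) \<le>
      (LINT \<theta>|circle_measure. M * (real k / \<rho> ^ k))"
      by (intro integral_mono integrable_norm int term_bound) auto
    then show ?thesis using prob_space by simp
  qed
  have "summable (\<lambda>k. LINT \<theta>|circle_measure. norm (coef k * dirichlet_sum k (cis \<theta>)))"
  proof (rule summable_comparison_test')
    show "summable (\<lambda>k. M * (real k / \<rho> ^ k))" by (rule summable_mult[OF summable_weights])
    show "norm (LINT \<theta>|circle_measure. norm (coef k * dirichlet_sum k (cis \<theta>))) \<le> M * (real k / \<rho> ^ k)" for k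
      using le by simp
  qed
  then have *: "(\<lambda>k. LINT \<theta>|circle_measure. coef k * dirichlet_sum k (cis \<theta>)) sums
      (LINT \<theta>|circle_measure. (\<Sum>k. coef k * dirichlet_sum k (cis \<theta>)))"
    by (intro sums_integral int) (auto intro!: summable_terms)
  have "(LINT \<theta>|circle_measure. antisym_quotient F (cis \<theta>)) =
      (LINT \<theta>|circle_measure. (\<Sum>k. coef k * dirichlet_sum k (cis \<theta>)))"
  proof (rule integral_cong_AE)
    show "AE \<theta> in circle_measure. antisym_quotient F (cis \<theta>) = (\<Sum>k. coef k * dirichlet_sum k (cis \<theta>))"
    proof -
      have "AE \<theta> in circle_measure. cis \<theta> \<notin> {1, -1}"
        by (rule AE_circle_measure_notin_finite) simp
      then show ?thesis by eventually_elim (auto intro!: antisym_quotient_series)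
    qed
    show "(\<lambda>\<theta>. antisym_quotient F (cis \<theta>)) \<in> borel_measurable circle_measure"
      by (rule measurable_antisym_quotient)
    show "(\<lambda>\<theta>. \<Sum>k. coef k * dirichlet_sum k (cis \<theta>)) \<in> borel_measurable circle_measure"
      by (intro borel_measurable_suminf borel_measurable_times meas) auto
  qed
  also have "\<dots> = (F 1 - F (-1)) / 2"
  proof (rule sums_unique2[OF *])
    have "(\<lambda>k. (coef k * 1 ^ k - coef k * (-1) ^ k) / 2) sums ((F 1 - F (-1)) / 2)"
      by (intro sums_divide sums_diff coef_sums) auto
    also have "(\<lambda>k. (coef k * 1 ^ k - coef k * (-1) ^ k) / 2) =
      (\<lambda>k. LINT \<theta>|circle_measure. coef k * dirichlet_sum k (cis \<theta>))"
      by (auto simp: fun_eq_iff integral_dirichlet_sum)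
    finally show "(\<lambda>k. LINT \<theta>|circle_measure. coef k * dirichlet_sum k (cis \<theta>)) sums ((F 1 - F (-1)) / 2)" .
  qed
  finally show ?thesis .
qed

end

section \<open>Letters and weights\<close>

datatype letter = Var nat | Inv nat | Fix complex

primrec letter_val :: "(nat \<Rightarrow> complex) \<Rightarrow> letter \<Rightarrow> complex" where
  "letter_val x (Var i) = x i"
| "letter_val x (Inv i) = inverse (x i)"
| "letter_val x (Fix y) = y"

definition letters :: "nat set \<Rightarrow> complex set \<Rightarrow> letter set" where
  "letters I Y = Var ` I \<union> Inv ` I \<union> Fix ` Y"

lemma finite_letters [simp]: "finite I \<Longrightarrow> finite Y \<Longrightarrow> finite (letters I Y)"
  by (simp add: letters_def)

lemma sum_letters:
  fixes f :: "letter \<Rightarrow> 'a::comm_monoid_add"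
  assumes "finite I" "finite Y"
  shows "(\<Sum>a\<in>letters I Y. f a) = (\<Sum>y\<in>Y. f (Fix y)) + (\<Sum>i\<in>I. f (Var i) + f (Inv i))"
proof -
  have "(\<Sum>a\<in>letters I Y. f a) = sum f (Var ` I) + sum f (Inv ` I) + sum f (Fix ` Y)"
    unfolding letters_def using assms by (subst sum.union_disjoint; auto)+
  then show ?thesis
    by (simp add: sum.reindex inj_on_def sum.distrib add_ac)
qed

lemma prod_letters:
  fixes f :: "letter \<Rightarrow> 'a::comm_monoid_mult"
  assumes "finite I" "finite Y"
  shows "(\<Prod>a\<in>letters I Y. f a) = (\<Prod>i\<in>I. f (Var i) * f (Inv i)) * (\<Prod>y\<in>Y. f (Fix y))"
proof -
  have "(\<Prod>a\<in>letters I Y. f a) = prod f (Var ` I) * prod f (Inv ` I) * prod f (Fix ` Y)"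
    unfolding letters_def using assms by (subst prod.union_disjoint; auto)+
  then show ?thesis
    by (simp add: prod.reindex inj_on_def prod.distrib mult_ac)
qed

lemma card_letters:
  assumes "finite I" "finite Y"
  shows "card (letters I Y) = 2 * card I + card Y"
  using sum_letters[OF assms, of "\<lambda>_. 1::nat"] by simp

definition var_weight :: "complex \<Rightarrow> complex set \<Rightarrow> complex \<Rightarrow> complex" where
  "var_weight t Y u =
     (\<Prod>y\<in>Y. one_minus_pm y u / one_minus_pm (t * y) u) / one_minus_pm t (u\<^sup>2)"

definition pair_weight :: "complex \<Rightarrow> complex \<Rightarrow> complex \<Rightarrow> complex" where
  "pair_weight t u v = one_minus_pm2 1 u v / one_minus_pm2 t u v"

text \<open>
  For \<open>Y = {-1}\<close> this is, up to the factor \<open>2^k k!\<close>, the Koornwinder density with parameters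
  \<open>1, -t, \<surd>t, -\<surd>t\<close>. The index set \<open>I\<close> is arbitrary since the recursion removes variables from the
  middle.
\<close>

definition torus_weight :: "complex \<Rightarrow> complex set \<Rightarrow> nat set \<Rightarrow> (nat \<Rightarrow> complex) \<Rightarrow> complex" where
  "torus_weight t Y I x = (\<Prod>i\<in>I. var_weight t Y (x i)) *
     (\<Prod>j\<in>I. \<Prod>i | i \<in> I \<and> i < j. pair_weight t (x i) (x j))"

lemma pair_weight_commute: "pair_weight t u v = pair_weight t v u"
  by (simp add: pair_weight_def one_minus_pm2_def mult_ac)

lemma pair_weight_inverse: "pair_weight t (inverse u) v = pair_weight t u v"
  by (simp add: pair_weight_def one_minus_pm2_def mult_ac)

lemma var_weight_inverse: "var_weight t Y (inverse u) = var_weight t Y u"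
  by (simp add: var_weight_def one_minus_pm_def mult_ac power_inverse)

lemma torus_weight_insert:
  assumes "finite I" "i \<notin> I"
  shows "torus_weight t Y (insert i I) x =
    var_weight t Y (x i) * (\<Prod>j\<in>I. pair_weight t (x i) (x j)) * torus_weight t Y I x"
proof -
  let ?w = "\<lambda>j k. pair_weight t (x j) (x k)"
  have "(\<Prod>j\<in>insert i I. \<Prod>k | k \<in> insert i I \<and> k < j. ?w k j) =
    (\<Prod>k | k \<in> I \<and> k < i. ?w k i) * (\<Prod>j\<in>I. \<Prod>k | k \<in> insert i I \<and> k < j. ?w k j)"
    using assms by (subst prod.insert) (auto intro!: prod.cong arg_cong2[where f = times])
  also have "(\<Prod>j\<in>I. \<Prod>k | k \<in> insert i I \<and> k < j. ?w k j) =
    (\<Prod>j\<in>I. (if i < j then ?w i j else 1) * (\<Prod>k | k \<in> I \<and> k < j. ?w k j))"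
  proof (rule prod.cong[OF refl])
    fix j assume "j \<in> I"
    have "{k. k \<in> insert i I \<and> k < j} = (if i < j then insert i {k. k \<in> I \<and> k < j} else {k. k \<in> I \<and> k < j})"
      by auto
    then show "(\<Prod>k | k \<in> insert i I \<and> k < j. ?w k j) =
      (if i < j then ?w i j else 1) * (\<Prod>k | k \<in> I \<and> k < j. ?w k j)"
      using assms by auto
  qed
  also have "\<dots> = (\<Prod>j\<in>I. if i < j then ?w i j else 1) * (\<Prod>j\<in>I. \<Prod>k | k \<in> I \<and> k < j. ?w k j)"
    by (rule prod.distrib)
  also have "(\<Prod>k | k \<in> I \<and> k < i. ?w k i) = (\<Prod>k\<in>I. if k < i then ?w i k else 1)"
    using assms by (subst prod.inter_filter) (auto intro!: prod.cong pair_weight_commute)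
  also have "\<dots> * ((\<Prod>j\<in>I. if i < j then ?w i j else 1) * (\<Prod>j\<in>I. \<Prod>k | k \<in> I \<and> k < j. ?w k j)) =
    (\<Prod>j\<in>I. (if j < i then ?w i j else 1) * (if i < j then ?w i j else 1)) *
      (\<Prod>j\<in>I. \<Prod>k | k \<in> I \<and> k < j. ?w k j)"
    by (simp add: prod.distrib mult.assoc)
  also have "(\<Prod>j\<in>I. (if j < i then ?w i j else 1) * (if i < j then ?w i j else 1)) = (\<Prod>j\<in>I. ?w i j)"
    using assms by (intro prod.cong) (auto simp: not_less_iff_gr_or_eq)
  finally show ?thesis
    using assms by (simp add: torus_weight_def mult_ac)
qed

lemma torus_weight_cong:
  "(\<And>i. i \<in> I \<Longrightarrow> x i = x' i) \<Longrightarrow> torus_weight t Y I x = torus_weight t Y I x'"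
  unfolding torus_weight_def by (intro arg_cong2[where f = times] prod.cong) auto

text \<open>
  Both signs are included among the letters so that a generic point stays generic when \<open>Y\<close> grows.
\<close>

definition generic_point :: "nat set \<Rightarrow> (nat \<Rightarrow> complex) \<Rightarrow> bool" where
  "generic_point I x \<longleftrightarrow> (\<forall>i\<in>I. norm (x i) = 1) \<and> inj_on (letter_val x) (letters I {1, -1})"

definition hl_integrand ::
    "complex \<Rightarrow> complex \<Rightarrow> complex set \<Rightarrow> nat set \<Rightarrow> nat list \<Rightarrow> (nat \<Rightarrow> complex) \<Rightarrow> complex" where
  "hl_integrand t \<alpha> Y I ls x = hl_sum t ls (letters I Y) (letter_val x) *
     (\<Prod>a\<in>letters I Y. 1 - \<alpha> * letter_val x a) * torus_weight t Y I x"

text \<open>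
  The part of \<open>hl_integrand\<close> for the partition \<open>l # ls\<close> in which the letter \<open>a\<close> fills the first slot.
\<close>

definition hl_summand ::
    "complex \<Rightarrow> complex \<Rightarrow> complex set \<Rightarrow> nat set \<Rightarrow> nat \<Rightarrow> nat list \<Rightarrow> letter \<Rightarrow> (nat \<Rightarrow> complex) \<Rightarrow> complex" where
  "hl_summand t \<alpha> Y I l ls a x =
     letter_val x a ^ l * (\<Prod>b\<in>letters I Y - {a}. hl_kernel t (letter_val x a) (letter_val x b)) *
     hl_sum t ls (letters I Y - {a}) (letter_val x) *
     (\<Prod>a\<in>letters I Y. 1 - \<alpha> * letter_val x a) * torus_weight t Y I x"

lemma hl_integrand_Cons:
  assumes "finite I" "finite Y"
  shows "hl_integrand t \<alpha> Y I (l # ls) x = (\<Sum>y\<in>Y. hl_summand t \<alpha> Y I l ls (Fix y) x) +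
    (\<Sum>i\<in>I. hl_summand t \<alpha> Y I l ls (Var i) x + hl_summand t \<alpha> Y I l ls (Inv i) x)"
proof -
  have "hl_integrand t \<alpha> Y I (l # ls) x = (\<Sum>a\<in>letters I Y. hl_summand t \<alpha> Y I l ls a x)"
    by (simp add: hl_integrand_def hl_summand_def sum_distrib_right)
  then show ?thesis unfolding sum_letters[OF assms] .
qed

lemma one_minus_nonzero:
  fixes t w :: complex
  assumes "norm t * norm w < 1"
  shows "1 - t * w \<noteq> 0"
proof
  assume "1 - t * w = 0"
  then have "norm (t * w) = 1" by simp
  then show False using assms by (simp add: norm_mult)
qed

lemma hl_kernel_altdef:
  "u \<noteq> 0 \<Longrightarrow> hl_kernel t u v = (1 - t * inverse u * v) / (1 - inverse u * v)"
proof -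
  assume u: "u \<noteq> 0"
  then have "u - t * v = u * (1 - t * inverse u * v)" "u - v = u * (1 - inverse u * v)"
    by (simp_all add: field_simps)
  then show ?thesis using u unfolding hl_kernel_def by simp
qed

lemma kernel_self_cancel:
  assumes u: "norm u = 1" "u \<noteq> 1" "u \<noteq> -1" and t: "norm t < 1"
  shows "hl_kernel t u (inverse u) / one_minus_pm t (u\<^sup>2) = u / (u - inverse u) / (1 - t * u\<^sup>2)"
proof -
  have u0: "u \<noteq> 0" using u by auto
  have ne: "u - inverse u \<noteq> 0" using circle_neq_inverse[OF u] by simp
  have "1 - t * (inverse u * inverse u) \<noteq> 0" "1 - t * u\<^sup>2 \<noteq> 0"
    by (rule one_minus_nonzero, use t u in \<open>simp add: norm_mult norm_inverse norm_power\<close>)+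
  moreover have "u - inverse u = u * (1 - inverse u * inverse u)"
    using u0 by (simp add: field_simps)
  moreover have "inverse (u\<^sup>2) = inverse u * inverse u" by (simp add: power2_eq_square)
  ultimately show ?thesis
    using u0 ne unfolding hl_kernel_altdef[OF u0] one_minus_pm_def mult.assoc by simp
qed

lemma kernel_fix_cancel:
  assumes u: "norm u = 1" and y: "norm y = 1" "u \<noteq> y" and t: "norm t < 1"
  shows "hl_kernel t u y * (one_minus_pm y u / one_minus_pm (t * y) u) = (1 - y * u) / (1 - t * y * u)"
proof -
  have u0: "u \<noteq> 0" using u by auto
  have "1 - t * (y * inverse u) \<noteq> 0" "1 - t * (y * u) \<noteq> 0"
    by (rule one_minus_nonzero, use t u y in \<open>simp add: norm_mult norm_inverse\<close>)+
  moreover have "1 - y * inverse u \<noteq> 0" using u0 y by (auto simp: field_simps)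
  ultimately show ?thesis
    unfolding hl_kernel_altdef[OF u0] one_minus_pm_def by (simp add: mult_ac)
qed

lemma kernel_pair_cancel:
  assumes u: "norm u = 1" and v: "norm v = 1" "u \<noteq> v" "u \<noteq> inverse v" and t: "norm t < 1"
  shows "hl_kernel t u v * hl_kernel t u (inverse v) * pair_weight t u v =
    ((1 - u * v) * (1 - u * inverse v)) / ((1 - t * u * v) * (1 - t * u * inverse v))"
proof -
  have u0: "u \<noteq> 0" "v \<noteq> 0" using u v by auto
  have cancel: "(p1 / q1) * (p2 / q2) * (c * d * q1 * q2 / (e * f * p1 * p2)) = c * d / (e * f)"
    if "p1 \<noteq> 0" "p2 \<noteq> 0" "q1 \<noteq> 0" "q2 \<noteq> 0" for p1 p2 q1 q2 c d e f :: complex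
    using that by simp
  have "1 - t * (inverse u * v) \<noteq> 0" "1 - t * (inverse u * inverse v) \<noteq> 0"
    by (rule one_minus_nonzero, use t u v in \<open>simp add: norm_mult norm_inverse\<close>)+
  moreover have "1 - inverse u * v \<noteq> 0" "1 - inverse u * inverse v \<noteq> 0"
    using u0 v by (auto simp: field_simps)
  ultimately show ?thesis
    unfolding hl_kernel_altdef[OF u0(1)] one_minus_pm2_def pair_weight_def mult_1_left
    by (intro cancel) (simp_all only: mult.assoc not_False_eq_True)
qed

text \<open>
  A sign is its own inverse; this is why its kernel factors against \<open>u\<close> and \<open>1/u\<close> are exactly the
  reciprocal of its factor in the weight.
\<close>

lemma sign_kernel_cancel:
  assumes y: "y \<in> {1, -1}" and u: "norm u = 1" "u \<noteq> 1" "u \<noteq> -1" and t: "norm t < 1"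
  shows "hl_kernel t y u * hl_kernel t y (inverse u) * (one_minus_pm y u / one_minus_pm (t * y) u) = 1"
proof -
  have y0: "y \<noteq> 0" "inverse y = y" "norm y = 1" "u \<noteq> 0" using y u by auto
  have "1 - t * (y * inverse u) \<noteq> 0" "1 - t * (y * u) \<noteq> 0"
    by (rule one_minus_nonzero, use t u y0 in \<open>simp add: norm_mult norm_inverse\<close>)+
  moreover have "1 - y * inverse u \<noteq> 0" "1 - y * u \<noteq> 0"
  proof -
    have "u \<noteq> y" using y u by auto
    then show "1 - y * inverse u \<noteq> 0" using y0 by (auto simp: field_simps)
    show "1 - y * u \<noteq> 0"
    proof
      assume "1 - y * u = 0"
      then have "u = inverse y" using y0 by (simp add: field_simps)
      with \<open>u \<noteq> y\<close> y0 show False by simp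
    qed
  qed
  ultimately show ?thesis
    unfolding hl_kernel_altdef[OF y0(1)] y0(2) one_minus_pm_def mult.assoc by simp
qed

section \<open>The letter in the first slot\<close>

lemma letters_remove_Fix: "letters I Y - {Fix y} = letters I (Y - {y})"
  by (auto simp: letters_def)

lemma letters_insert: "letters (insert i I) Y = insert (Var i) (insert (Inv i) (letters I Y))"
  by (auto simp: letters_def)

lemma letters_not_mem: "i \<notin> I \<Longrightarrow> Var i \<notin> letters I Y" "i \<notin> I \<Longrightarrow> Inv i \<notin> letters I Y"
  by (auto simp: letters_def)

lemma letters_mono: "Y \<subseteq> Z \<Longrightarrow> letters I Y \<subseteq> letters I Z"
  by (auto simp: letters_def)

lemma letter_val_upd: "i \<notin> I \<Longrightarrow> a \<in> letters I Y \<Longrightarrow> letter_val (x(i := v)) a = letter_val x a"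
  by (auto simp: letters_def)

lemma generic_point_neq_sign:
  assumes "generic_point I x" "i \<in> I"
  shows "norm (x i) = 1" "x i \<noteq> 1" "x i \<noteq> -1"
proof -
  have inj: "letter_val x a = letter_val x b \<Longrightarrow> a = b"
    if "a \<in> letters I {1, -1}" "b \<in> letters I {1, -1}" for a b
    using assms that unfolding generic_point_def by (auto dest: inj_onD)
  show "norm (x i) = 1" using assms by (simp add: generic_point_def)
  show "x i \<noteq> 1" using inj[of "Var i" "Fix 1"] assms by (auto simp: letters_def)
  show "x i \<noteq> -1" using inj[of "Var i" "Fix (-1)"] assms by (auto simp: letters_def)
qed

lemma norm_letter_val:
  assumes "\<forall>i\<in>I. norm (x i) = 1" "Y \<subseteq> {1, -1}" "a \<in> letters I Y"
  shows "norm (letter_val x a) = 1"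
  using assms by (auto simp: letters_def norm_inverse)

lemma hl_summand_Fix:
  assumes "finite I" and x: "generic_point I x" and Y: "Y \<subseteq> {1, -1}" "y \<in> Y" and t: "norm t < 1"
  shows "hl_summand t \<alpha> Y I l ls (Fix y) x =
    y ^ l * (1 - \<alpha> * y) * (\<Prod>d\<in>Y - {y}. hl_kernel t y d) * hl_integrand t \<alpha> (Y - {y}) I ls x"
proof -
  have fin: "finite Y" using Y by (auto intro: finite_subset)
  have K: "(\<Prod>b\<in>letters I Y - {Fix y}. hl_kernel t y (letter_val x b)) =
    (\<Prod>i\<in>I. hl_kernel t y (x i) * hl_kernel t y (inverse (x i))) * (\<Prod>d\<in>Y - {y}. hl_kernel t y d)"
    unfolding letters_remove_Fix using assms fin by (subst prod_letters) auto
  have P: "(\<Prod>a\<in>letters I Y. 1 - \<alpha> * letter_val x a) =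
    (1 - \<alpha> * y) * (\<Prod>a\<in>letters I (Y - {y}). 1 - \<alpha> * letter_val x a)"
  proof -
    have "Fix y \<in> letters I Y" using Y by (auto simp: letters_def)
    then show ?thesis
      using assms fin by (simp add: prod.remove[of "letters I Y" "Fix y"] letters_remove_Fix)
  qed
  have vw: "hl_kernel t y (x i) * hl_kernel t y (inverse (x i)) * var_weight t Y (x i) =
    var_weight t (Y - {y}) (x i)" if i: "i \<in> I" for i
  proof -
    have "var_weight t Y (x i) = one_minus_pm y (x i) / one_minus_pm (t * y) (x i) * var_weight t (Y - {y}) (x i)"
      unfolding var_weight_def using Y fin by (simp add: prod.remove[of Y y])
    then have "hl_kernel t y (x i) * hl_kernel t y (inverse (x i)) * var_weight t Y (x i) =
      (hl_kernel t y (x i) * hl_kernel t y (inverse (x i)) *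
        (one_minus_pm y (x i) / one_minus_pm (t * y) (x i))) * var_weight t (Y - {y}) (x i)"
      by (simp only: mult.assoc)
    also have "\<dots> = var_weight t (Y - {y}) (x i)"
      using sign_kernel_cancel[of y "x i" t] generic_point_neq_sign[OF x i] Y t by (simp add: subset_iff)
    finally show ?thesis .
  qed
  have W: "(\<Prod>i\<in>I. hl_kernel t y (x i) * hl_kernel t y (inverse (x i))) * torus_weight t Y I x =
    torus_weight t (Y - {y}) I x"
    unfolding torus_weight_def mult.assoc[symmetric] prod.distrib[symmetric]
    by (simp add: vw cong: prod.cong)
  show ?thesis
    unfolding hl_summand_def hl_integrand_def letter_val.simps K P W[symmetric]
    by (simp add: letters_remove_Fix mult_ac)
qed

text \<open>
  The function \<open>F\<close> of the quotient \<open>(F u - F (1/u)) / (u - 1/u)\<close> that arises from the terms with \<open>x\<^sub>i\<close>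
  or \<open>1/x\<^sub>i\<close> in the first slot. Here \<open>I\<close> and \<open>x\<close> are the remaining variables, and \<open>p\<close> is the shorter
  sum as a polynomial in the letter that is left over from the pair. The sum over \<open>k\<close> is
  \<open>u^l * p (1/u)\<close>, written without negative powers.
\<close>

definition peel_fun ::
    "complex \<Rightarrow> complex \<Rightarrow> complex set \<Rightarrow> nat set \<Rightarrow> nat \<Rightarrow> complex poly \<Rightarrow> (nat \<Rightarrow> complex) \<Rightarrow> complex \<Rightarrow> complex" where
  "peel_fun t \<alpha> Y I l p x u =
     (1 - \<alpha> * u) * (u - \<alpha>) * (\<Sum>k\<le>l. coeff p k * u ^ (l - k)) *
     ((\<Prod>y\<in>Y. (1 - y * u) / (1 - t * y * u)) / (1 - t * u\<^sup>2)) *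
     (\<Prod>j\<in>I. ((1 - u * x j) * (1 - u * inverse (x j))) /
        ((1 - t * u * x j) * (1 - t * u * inverse (x j)))) *
     ((\<Prod>a\<in>letters I Y. 1 - \<alpha> * letter_val x a) * torus_weight t Y I x)"

lemma reflected_poly_sum:
  fixes u :: complex
  assumes "u \<noteq> 0" "degree p \<le> l"
  shows "(\<Sum>k\<le>l. coeff p k * u ^ (l - k)) = u ^ l * poly p (inverse u)"
proof -
  have "poly p (inverse u) = (\<Sum>k\<le>l. coeff p k * inverse u ^ k)"
    unfolding poly_altdef using assms by (intro sum.mono_neutral_left) (auto simp: coeff_eq_0)
  then show ?thesis
    using assms by (auto simp: sum_distrib_left power_diff divide_inverse power_inverse mult_ac intro!: sum.cong)
qed

text \<open>
  The letter \<open>a\<close> with value \<open>w\<close> stands in the first slot and \<open>b\<close>, with value \<open>1/w\<close>, is its partner.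
  Both orders of the pair are covered at once since the weight is invariant under inversion of a
  variable. The numerators of the kernel factors of \<open>a\<close> cancel the denominators of the weight that
  vanish inside the unit disc, and their denominators cancel against numerators of the weight;
  only \<open>w - 1/w\<close> is left over.
\<close>

lemma hl_summand_paired:
  assumes I: "finite I" "i \<notin> I" and Y: "Y \<subseteq> {1, -1}" and t: "norm t < 1"
    and ab: "{a, b} = {Var i, Inv i}" "a \<noteq> b"
    and v: "letter_val (x(i := v)) a = w" "letter_val (x(i := v)) b = inverse w"
    and w: "norm w = 1" "w \<notin> letter_val x ` letters I {1, -1}" "w \<noteq> 1" "w \<noteq> -1"
    and w': "inverse w \<notin> letter_val x ` letters I {1, -1}"
    and x: "\<forall>i\<in>I. norm (x i) = 1"
    and p: "degree p \<le> l"
      "\<And>v. v \<notin> letter_val x ` letters I Y \<Longrightarrow>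
        hl_sum t ls (insert (Inv i) (letters I Y)) ((letter_val x)(Inv i := v)) = poly p v"
  shows "hl_summand t \<alpha> Y (insert i I) l ls a (x(i := v)) = peel_fun t \<alpha> Y I l p x w / (w - inverse w)"
proof -
  have fin: "finite Y" using Y by (auto intro: finite_subset)
  let ?L = "letters I Y" and ?z = "letter_val (x(i := v))"
  have nm: "a \<notin> ?L" "b \<notin> ?L" "Inv i \<notin> ?L"
    using ab letters_not_mem[OF I(2), of Y] by (auto simp: doubleton_eq_iff)
  have L: "letters (insert i I) Y = insert a (insert b ?L)"
    using ab by (auto simp: letters_insert)
  have L': "letters (insert i I) Y - {a} = insert b ?L"
    unfolding L using nm ab by auto
  have z: "?z c = letter_val x c" if "c \<in> ?L" for c
    using letter_val_upd[OF I(2) that] .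
  have w0: "w \<noteq> 0" using w by auto
  have wx: "w \<noteq> x j" "w \<noteq> inverse (x j)" if "j \<in> I" for j
    using w(2) that by (auto simp: letters_def image_Un image_image)
  have wY: "w \<noteq> y" if "y \<in> Y" for y using w(3,4) Y that by auto
  have nY: "norm y = 1" if "y \<in> Y" for y using Y that by auto
  have K: "(\<Prod>c\<in>letters (insert i I) Y - {a}. hl_kernel t w (?z c)) =
    hl_kernel t w (inverse w) * ((\<Prod>j\<in>I. hl_kernel t w (x j) * hl_kernel t w (inverse (x j))) *
      (\<Prod>y\<in>Y. hl_kernel t w y))"
  proof -
    have "(\<Prod>c\<in>?L. hl_kernel t w (?z c)) = (\<Prod>c\<in>?L. hl_kernel t w (letter_val x c))"
      by (rule prod.cong) (simp_all add: z)
    then show ?thesis unfolding L' using nm I fin v by (simp add: prod_letters)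
  qed
  have A: "(\<Prod>c\<in>letters (insert i I) Y. 1 - \<alpha> * ?z c) =
    (1 - \<alpha> * w) * (1 - \<alpha> * inverse w) * (\<Prod>a\<in>?L. 1 - \<alpha> * letter_val x a)"
  proof -
    have "(\<Prod>c\<in>?L. 1 - \<alpha> * ?z c) = (\<Prod>c\<in>?L. 1 - \<alpha> * letter_val x c)"
      by (rule prod.cong) (simp_all add: z)
    then show ?thesis unfolding L using nm I fin v ab by (simp add: mult.assoc)
  qed
  have H: "hl_sum t ls (letters (insert i I) Y - {a}) ?z = poly p (inverse w)"
  proof -
    have "hl_sum t ls (letters (insert i I) Y - {a}) ?z = hl_sum t ls ((id(Inv i := b)) ` insert (Inv i) ?L) ?z"
      unfolding L' using nm by (intro arg_cong[where f = "\<lambda>A. hl_sum t ls A ?z"]) (auto simp: image_iff)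
    also have "\<dots> = hl_sum t ls (insert (Inv i) ?L) (?z \<circ> id(Inv i := b))"
      using nm by (intro hl_sum_reindex) (auto simp: inj_on_def)
    also have "\<dots> = hl_sum t ls (insert (Inv i) ?L) ((letter_val x)(Inv i := inverse w))"
      using v nm z by (intro hl_sum_cong) auto
    also have "\<dots> = poly p (inverse w)"
      using w' letters_mono[OF Y, of I] by (intro p) auto
    finally show ?thesis .
  qed
  have xv: "(x(i := v)) i = w \<or> (x(i := v)) i = inverse w"
    using ab v by (auto simp: doubleton_eq_iff)
  have W: "torus_weight t Y (insert i I) (x(i := v)) =
    var_weight t Y w * (\<Prod>j\<in>I. pair_weight t w (x j)) * torus_weight t Y I x"
  proof -
    have "var_weight t Y ((x(i := v)) i) = var_weight t Y w"
      using xv var_weight_inverse by metis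
    moreover have "pair_weight t ((x(i := v)) i) ((x(i := v)) j) = pair_weight t w (x j)" if "j \<in> I" for j
    proof -
      have "(x(i := v)) j = x j" using that I by auto
      then show ?thesis using xv pair_weight_inverse by metis
    qed
    moreover have "torus_weight t Y I (x(i := v)) = torus_weight t Y I x"
      using I by (intro torus_weight_cong) auto
    ultimately show ?thesis
      unfolding torus_weight_insert[OF I] by (simp cong: prod.cong)
  qed
  have c1: "hl_kernel t w (inverse w) * (\<Prod>y\<in>Y. hl_kernel t w y) * var_weight t Y w =
    w / (w - inverse w) * ((\<Prod>y\<in>Y. (1 - y * w) / (1 - t * y * w)) / (1 - t * w\<^sup>2))"
  proof -
    have "hl_kernel t w (inverse w) * (\<Prod>y\<in>Y. hl_kernel t w y) * var_weight t Y w =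
      (hl_kernel t w (inverse w) / one_minus_pm t (w\<^sup>2)) *
      (\<Prod>y\<in>Y. hl_kernel t w y * (one_minus_pm y w / one_minus_pm (t * y) w))"
      unfolding var_weight_def prod.distrib by (simp add: mult_ac)
    also have "(\<Prod>y\<in>Y. hl_kernel t w y * (one_minus_pm y w / one_minus_pm (t * y) w)) =
      (\<Prod>y\<in>Y. (1 - y * w) / (1 - t * y * w))"
      by (rule prod.cong[OF refl], rule kernel_fix_cancel) (use w wY nY t in auto)
    also have "hl_kernel t w (inverse w) / one_minus_pm t (w\<^sup>2) = w / (w - inverse w) / (1 - t * w\<^sup>2)"
      by (rule kernel_self_cancel) (use w t in auto)
    finally show ?thesis by simp
  qed
  have c2: "(\<Prod>j\<in>I. hl_kernel t w (x j) * hl_kernel t w (inverse (x j))) * (\<Prod>j\<in>I. pair_weight t w (x j)) =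
    (\<Prod>j\<in>I. ((1 - w * x j) * (1 - w * inverse (x j))) / ((1 - t * w * x j) * (1 - t * w * inverse (x j))))"
    unfolding prod.distrib[symmetric]
    by (rule prod.cong[OF refl], rule kernel_pair_cancel) (use w wx x t in auto)
  have e: "hl_summand t \<alpha> Y (insert i I) l ls a (x(i := v)) =
    (w ^ l * poly p (inverse w)) *
    (hl_kernel t w (inverse w) * (\<Prod>y\<in>Y. hl_kernel t w y) * var_weight t Y w) *
    ((\<Prod>j\<in>I. hl_kernel t w (x j) * hl_kernel t w (inverse (x j))) * (\<Prod>j\<in>I. pair_weight t w (x j))) *
    ((1 - \<alpha> * w) * (1 - \<alpha> * inverse w)) * ((\<Prod>a\<in>?L. 1 - \<alpha> * letter_val x a) * torus_weight t Y I x)"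
    unfolding hl_summand_def v K A H W by (simp only: mult_ac)
  have f1: "w ^ l * poly p (inverse w) = (\<Sum>k\<le>l. coeff p k * w ^ (l - k))"
    using reflected_poly_sum[OF w0 p(1)] by simp
  have f2: "(1 - \<alpha> * w) * (1 - \<alpha> * inverse w) = (1 - \<alpha> * w) * (w - \<alpha>) / w"
    using w0 by (simp add: field_simps)
  show ?thesis
    unfolding e f1 f2 c1 c2 peel_fun_def using w0 by (simp add: mult_ac)
qed

lemma letter_values_inverse_closed:
  assumes "inverse u \<in> letter_val x ` letters I {1, -1}"
  shows "u \<in> letter_val x ` letters I {1, -1}"
proof -
  obtain c where c: "c \<in> letters I {1, -1}" "inverse u = letter_val x c" using assms by auto
  have u: "u = inverse (letter_val x c)" using c(2) by (metis inverse_inverse_eq)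
  show ?thesis
  proof (cases c)
    case (Var j)
    then show ?thesis using c(1) u by (intro image_eqI[of _ _ "Inv j"]) (auto simp: letters_def)
  next
    case (Inv j)
    then show ?thesis using c(1) u by (intro image_eqI[of _ _ "Var j"]) (auto simp: letters_def)
  next
    case (Fix y)
    then show ?thesis using c(1) u by (intro image_eqI[of _ _ c]) (auto simp: letters_def)
  qed
qed

lemma sign_mem_letter_values: "s \<in> {1, -1} \<Longrightarrow> s \<in> letter_val x ` letters I {1, -1}"
  by (rule image_eqI[of _ _ "Fix s"]) (auto simp: letters_def)

lemma hl_summand_pair_eq_quotient:
  assumes I: "finite I" "i \<notin> I" and Y: "Y \<subseteq> {1, -1}" and t: "norm t < 1"
    and u: "norm u = 1" "u \<notin> letter_val x ` letters I {1, -1}"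
    and x: "\<forall>i\<in>I. norm (x i) = 1"
    and p: "degree p \<le> l"
      "\<And>v. v \<notin> letter_val x ` letters I Y \<Longrightarrow>
        hl_sum t ls (insert (Inv i) (letters I Y)) ((letter_val x)(Inv i := v)) = poly p v"
  shows "hl_summand t \<alpha> Y (insert i I) l ls (Var i) (x(i := u)) +
      hl_summand t \<alpha> Y (insert i I) l ls (Inv i) (x(i := u)) =
    antisym_quotient (peel_fun t \<alpha> Y I l p x) u"
proof -
  have u': "inverse u \<notin> letter_val x ` letters I {1, -1}"
    using letter_values_inverse_closed u(2) by blast
  have ne: "u \<noteq> 1" "u \<noteq> -1" "inverse u \<noteq> 1" "inverse u \<noteq> -1"
    using sign_mem_letter_values[of _ x I] u(2) u' by (metis insertCI)+
  have "hl_summand t \<alpha> Y (insert i I) l ls (Var i) (x(i := u)) = peel_fun t \<alpha> Y I l p x u / (u - inverse u)"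
    by (rule hl_summand_paired[where b = "Inv i"]) (use assms u' ne in auto)
  moreover have "hl_summand t \<alpha> Y (insert i I) l ls (Inv i) (x(i := u)) =
      peel_fun t \<alpha> Y I l p x (inverse u) / (inverse u - inverse (inverse u))"
    by (rule hl_summand_paired[where b = "Var i"]) (use assms u' ne in \<open>auto simp: norm_inverse\<close>)
  moreover have "inverse u - inverse (inverse u) = - (u - inverse u)" by simp
  ultimately show ?thesis
    unfolding antisym_quotient_def by (simp only: divide_minus_right diff_divide_distrib) simp
qed

text \<open>
  The multiple that appears when a variable is frozen at the sign \<open>s\<close>.
\<close>

definition residue_factor :: "complex \<Rightarrow> complex \<Rightarrow> complex set \<Rightarrow> nat \<Rightarrow> complex \<Rightarrow> complex" where
  "residue_factor t \<alpha> Y l s =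
     s ^ l * (1 - \<alpha> * s) / (1 - t) * (\<Prod>y\<in>Y. (1 - y * s) / (1 - t * y * s))"

lemma peel_fun_sign_in:
  assumes "finite Y" "s \<in> Y" "s \<in> {1, -1}"
  shows "peel_fun t \<alpha> Y I l p x s = 0"
proof -
  have "(\<Prod>y\<in>Y. (1 - y * s) / (1 - t * y * s)) = 0"
    using assms by (auto intro!: prod_zero bexI[of _ s])
  then show ?thesis by (simp add: peel_fun_def)
qed

text \<open>
  At \<open>u = s\<close> the partner \<open>1/u\<close> of the peeled letter takes the value \<open>s\<close> as well and becomes a new
  fixed letter; the factors of \<open>F\<close> that couple \<open>u\<close> to the other variables become the factor of
  \<open>s\<close> in the weight for \<open>Y \<union> {s}\<close>.
\<close>

lemma peel_fun_sign_notin: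
  assumes I: "finite I" "i \<notin> I" and Y: "Y \<subseteq> {1, -1}" and s: "s \<in> {1, -1}" "s \<notin> Y"
    and x: "generic_point I x"
    and p: "degree p \<le> l"
      "\<And>v. v \<notin> letter_val x ` letters I Y \<Longrightarrow>
        hl_sum t ls (insert (Inv i) (letters I Y)) ((letter_val x)(Inv i := v)) = poly p v"
  shows "peel_fun t \<alpha> Y I l p x s = s * residue_factor t \<alpha> Y l s * hl_integrand t \<alpha> (insert s Y) I ls x"
proof -
  have fin: "finite Y" using Y by (auto intro: finite_subset)
  have s0: "s \<noteq> 0" "inverse s = s" "s\<^sup>2 = 1" using s by auto
  let ?L = "letters I Y"
  have L: "letters I (insert s Y) = insert (Fix s) ?L" by (auto simp: letters_def)
  have nm: "Fix s \<notin> ?L" "Inv i \<notin> ?L" using s I by (auto simp: letters_def)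
  have inj: "inj_on (letter_val x) (letters I {1, -1})" using x by (simp add: generic_point_def)
  have sub: "?L \<subseteq> letters I {1, -1}" using Y by (rule letters_mono)
  have "s \<notin> letter_val x ` ?L"
  proof
    assume "s \<in> letter_val x ` ?L"
    then obtain c where c: "c \<in> ?L" "letter_val x (Fix s) = letter_val x c" by auto
    have "Fix s \<in> letters I {1, -1}" using s by (auto simp: letters_def)
    then have "c = Fix s" using c inj sub by (metis inj_onD subsetD)
    then show False using c nm by simp
  qed
  then have "poly p s = hl_sum t ls (insert (Inv i) ?L) ((letter_val x)(Inv i := s))"
    using p(2) by simp
  also have "\<dots> = hl_sum t ls (insert (Inv i) ?L) (letter_val x \<circ> id(Inv i := Fix s))"
    by (rule hl_sum_cong) auto
  also have "\<dots> = hl_sum t ls ((id(Inv i := Fix s)) ` insert (Inv i) ?L) (letter_val x)"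
    using nm by (intro hl_sum_reindex[symmetric]) (auto simp: inj_on_def)
  also have "(id(Inv i := Fix s)) ` insert (Inv i) ?L = letters I (insert s Y)"
    unfolding L using nm by (auto simp: image_iff)
  finally have H: "poly p s = hl_sum t ls (letters I (insert s Y)) (letter_val x)" .
  have A: "(\<Prod>a\<in>letters I (insert s Y). 1 - \<alpha> * letter_val x a) =
      (1 - \<alpha> * s) * (\<Prod>a\<in>?L. 1 - \<alpha> * letter_val x a)"
    unfolding L using nm I fin by simp
  have "var_weight t (insert s Y) (x j) =
    ((1 - s * x j) * (1 - s * inverse (x j))) / ((1 - t * s * x j) * (1 - t * s * inverse (x j))) * var_weight t Y (x j)" for j
    using s fin by (simp add: var_weight_def one_minus_pm_def)
  then have W: "torus_weight t (insert s Y) I x = 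
    (\<Prod>j\<in>I. ((1 - s * x j) * (1 - s * inverse (x j))) / ((1 - t * s * x j) * (1 - t * s * inverse (x j)))) *
    torus_weight t Y I x"
    unfolding torus_weight_def by (simp only: prod.distrib mult.assoc)
  have "s - \<alpha> = s * (1 - \<alpha> * s)" using s0 by (simp add: algebra_simps power2_eq_square)
  then show ?thesis
    unfolding peel_fun_def reflected_poly_sum[OF s0(1) p(1)] s0 H residue_factor_def hl_integrand_def A W
    by (simp only: mult_ac times_divide_eq_right times_divide_eq_left mult_1_right mult_1_left)
qed

section \<open>Uniform bounds\<close>

definition unif_bounded :: "'s set \<Rightarrow> ('s \<Rightarrow> complex) \<Rightarrow> bool" where
  "unif_bounded S f \<longleftrightarrow> (\<exists>C. \<forall>s\<in>S. norm (f s) \<le> C)"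

definition bounded_away :: "'s set \<Rightarrow> ('s \<Rightarrow> complex) \<Rightarrow> bool" where
  "bounded_away S f \<longleftrightarrow> (\<exists>c>0. \<forall>s\<in>S. c \<le> norm (f s))"

lemma unif_boundedI: "(\<And>s. s \<in> S \<Longrightarrow> norm (f s) \<le> C) \<Longrightarrow> unif_bounded S f"
  unfolding unif_bounded_def by blast

lemma unif_bounded_const: "unif_bounded S (\<lambda>_. c)"
  by (rule unif_boundedI[of _ _ "norm c"]) simp

lemma unif_bounded_add:
  assumes "unif_bounded S f" "unif_bounded S g"
  shows "unif_bounded S (\<lambda>s. f s + g s)"
proof -
  obtain C D where "\<forall>s\<in>S. norm (f s) \<le> C" "\<forall>s\<in>S. norm (g s) \<le> D"
    using assms unfolding unif_bounded_def by blast
  then show ?thesis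
    by (intro unif_boundedI[of _ _ "C + D"] norm_triangle_mono) auto
qed

lemma unif_bounded_uminus: "unif_bounded S f \<Longrightarrow> unif_bounded S (\<lambda>s. - f s)"
  by (simp add: unif_bounded_def)

lemma unif_bounded_diff:
  "unif_bounded S f \<Longrightarrow> unif_bounded S g \<Longrightarrow> unif_bounded S (\<lambda>s. f s - g s)"
  using unif_bounded_add[of S f "\<lambda>s. - g s"] unif_bounded_uminus[of S g] by simp

lemma unif_bounded_mult:
  assumes "unif_bounded S f" "unif_bounded S g"
  shows "unif_bounded S (\<lambda>s. f s * g s)"
proof -
  obtain C D where CD: "\<forall>s\<in>S. norm (f s) \<le> C" "\<forall>s\<in>S. norm (g s) \<le> D"
    using assms unfolding unif_bounded_def by blast
  show ?thesis
  proof (rule unif_boundedI[of _ _ "C * D"])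
    fix s assume "s \<in> S"
    then have "norm (f s) \<le> C" "norm (g s) \<le> D" using CD by auto
    then show "norm (f s * g s) \<le> C * D"
      unfolding norm_mult by (intro mult_mono order.trans[OF norm_ge_zero]) auto
  qed
qed

lemma unif_bounded_sum:
  "finite A \<Longrightarrow> (\<And>a. a \<in> A \<Longrightarrow> unif_bounded S (f a)) \<Longrightarrow> unif_bounded S (\<lambda>s. \<Sum>a\<in>A. f a s)"
  by (induction A rule: finite_induct) (auto intro: unif_bounded_add unif_bounded_const)

lemma unif_bounded_prod:
  "finite A \<Longrightarrow> (\<And>a. a \<in> A \<Longrightarrow> unif_bounded S (f a)) \<Longrightarrow> unif_bounded S (\<lambda>s. \<Prod>a\<in>A. f a s)"
  by (induction A rule: finite_induct) (auto intro: unif_bounded_mult unif_bounded_const)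

lemma unif_bounded_power: "unif_bounded S f \<Longrightarrow> unif_bounded S (\<lambda>s. f s ^ n)"
  by (induction n) (auto intro: unif_bounded_mult unif_bounded_const)

lemma unif_bounded_divide:
  assumes "unif_bounded S f" "bounded_away S g"
  shows "unif_bounded S (\<lambda>s. f s / g s)"
proof -
  obtain C c where C: "\<forall>s\<in>S. norm (f s) \<le> C" and c: "c > 0" "\<forall>s\<in>S. c \<le> norm (g s)"
    using assms unfolding unif_bounded_def bounded_away_def by blast
  show ?thesis
  proof (rule unif_boundedI[of _ _ "C / c"])
    fix s assume "s \<in> S"
    then have "norm (f s) \<le> C" "c \<le> norm (g s)" using C c by auto
    then show "norm (f s / g s) \<le> C / c"
      unfolding norm_divide using c order.trans[OF norm_ge_zero[of "f s"]] by (intro frac_le) auto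
  qed
qed

lemma bounded_away_mult:
  assumes "bounded_away S f" "bounded_away S g"
  shows "bounded_away S (\<lambda>s. f s * g s)"
proof -
  obtain C D where "C > 0" "\<forall>s\<in>S. C \<le> norm (f s)" "D > 0" "\<forall>s\<in>S. D \<le> norm (g s)"
    using assms unfolding bounded_away_def by blast
  then show ?thesis
    unfolding bounded_away_def norm_mult by (intro exI[of _ "C * D"]) (auto intro!: mult_mono)
qed

lemma bounded_away_one_minus:
  assumes "q < 1" "\<And>s. s \<in> S \<Longrightarrow> norm (h s) \<le> q"
  shows "bounded_away S (\<lambda>s. 1 - h s)"
  unfolding bounded_away_def
proof (intro exI conjI ballI)
  show "1 - q > 0" using assms by simp
  fix s assume "s \<in> S"
  then show "1 - q \<le> norm (1 - h s)"
    using assms(2)[of s] norm_triangle_ineq2[of 1 "h s"] by simp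
qed

lemmas unif_bounded_intros = unif_bounded_const unif_bounded_add unif_bounded_diff unif_bounded_mult
  unif_bounded_sum unif_bounded_prod unif_bounded_power unif_bounded_divide bounded_away_mult

lemma torus_weight_bounded:
  assumes I: "finite I" and Y: "Y \<subseteq> {1, -1}" and t: "norm t < 1"
    and f: "\<And>s i. s \<in> S \<Longrightarrow> i \<in> I \<Longrightarrow> norm (f s i) = 1"
  shows "unif_bounded S (\<lambda>s. torus_weight t Y I (f s))"
proof -
  have fin: "finite Y" using Y by (auto intro: finite_subset)
  have nY: "norm y = 1" if "y \<in> Y" for y using Y that by auto
  have 1: "unif_bounded S (\<lambda>s. f s i)" "unif_bounded S (\<lambda>s. inverse (f s i))" if "i \<in> I" for i
    by (rule unif_boundedI[of _ _ 1], simp add: f that norm_inverse)+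
  have 2: "bounded_away S (\<lambda>s. 1 - t * f s i * f s j)" "bounded_away S (\<lambda>s. 1 - t * f s i * inverse (f s j))"
    "bounded_away S (\<lambda>s. 1 - t * inverse (f s i) * f s j)"
    "bounded_away S (\<lambda>s. 1 - t * inverse (f s i) * inverse (f s j))"
    "bounded_away S (\<lambda>s. 1 - t * (f s i)\<^sup>2)" "bounded_away S (\<lambda>s. 1 - t * inverse ((f s i)\<^sup>2))"
    if "i \<in> I" "j \<in> I" for i j
    by (rule bounded_away_one_minus[OF t], simp add: f that norm_inverse norm_mult norm_power)+
  have 3: "bounded_away S (\<lambda>s. 1 - t * y * f s i)" "bounded_away S (\<lambda>s. 1 - t * y * inverse (f s i))"
    if "i \<in> I" "y \<in> Y" for i y
    by (rule bounded_away_one_minus[OF t], simp add: f that nY norm_inverse norm_mult norm_power)+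
  show ?thesis
    unfolding torus_weight_def var_weight_def pair_weight_def one_minus_pm_def one_minus_pm2_def mult_1_left
    by (intro unif_bounded_intros 1 2 3) (use I fin in auto)
qed

lemma hl_integrand_bounded:
  assumes I: "finite I" and Y: "Y \<subseteq> {1, -1}" and t: "norm t < 1"
  shows "\<exists>C. \<forall>x. generic_point I x \<longrightarrow> norm (hl_integrand t \<alpha> Y I ls x) \<le> C"
proof -
  have "finite Y" using Y by (auto intro: finite_subset)
  then have fin: "finite (letters I Y)" using I by simp
  let ?S = "{x. generic_point I x}"
  obtain M where M: "\<And>z. inj_on z (letters I Y) \<Longrightarrow> (\<forall>b\<in>letters I Y. norm (z b) = 1) \<Longrightarrow>
      norm (hl_sum t ls (letters I Y \<union> {}) z) \<le> M"
    using hl_sum_bounded[OF fin, of "{}" "\<lambda>_. 0" t ls] by auto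
  have one: "\<forall>i\<in>I. norm (x i) = 1" if "x \<in> ?S" for x using that by (simp add: generic_point_def)
  have "unif_bounded ?S (\<lambda>x. hl_sum t ls (letters I Y) (letter_val x))"
  proof (rule unif_boundedI)
    fix x assume x: "x \<in> ?S"
    then have "inj_on (letter_val x) (letters I Y)"
      using letters_mono[OF Y] by (auto simp: generic_point_def intro: inj_on_subset)
    then show "norm (hl_sum t ls (letters I Y) (letter_val x)) \<le> M"
      using M[of "letter_val x"] norm_letter_val[OF one[OF x] Y] by simp
  qed
  moreover have "unif_bounded ?S (\<lambda>x. letter_val x a)" if "a \<in> letters I Y" for a
    by (rule unif_boundedI[of _ _ 1]) (simp add: norm_letter_val[OF one Y that])
  ultimately have "unif_bounded ?S (hl_integrand t \<alpha> Y I ls)"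
    unfolding hl_integrand_def using fin one
    by (intro unif_bounded_intros torus_weight_bounded[OF I Y t]) auto
  then show ?thesis by (simp add: unif_bounded_def)
qed

text \<open>
  A radius for which the zeros of \<open>1 - t u^2\<close> and \<open>1 - t u w\<close>, \<open>|w| = 1\<close>, stay outside the disc.
\<close>

lemma exists_radius:
  fixes t :: complex
  assumes "norm t < 1"
  obtains \<rho> where "\<rho> > 1" "norm t * \<rho>\<^sup>2 < 1" "norm t * \<rho> < 1"
proof
  \<comment> \<open>With this choice \<open>|t| * \<rho>^2 = 2|t| / (1 + |t|)\<close>, which is less than 1 since \<open>|t|\<close> is.\<close>
  define \<rho> where "\<rho> = sqrt (2 / (1 + norm t))"
  have n0: "1 + norm t > 0" by (simp add: add_pos_nonneg)
  have sq: "\<rho>\<^sup>2 = 2 / (1 + norm t)" unfolding \<rho>_def using n0 by simp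
  show "\<rho> > 1" unfolding \<rho>_def using assms n0 by simp
  show 2: "norm t * \<rho>\<^sup>2 < 1" unfolding sq using assms n0 by (simp add: field_simps)
  have "norm t * \<rho> \<le> norm t * \<rho>\<^sup>2"
    using \<open>\<rho> > 1\<close> by (intro mult_left_mono) (auto simp: power2_eq_square)
  then show "norm t * \<rho> < 1" using 2 by simp
qed

lemma peel_fun_holomorphic:
  assumes Y: "Y \<subseteq> {1, -1}" and \<rho>: "norm t * \<rho>\<^sup>2 < 1" "norm t * \<rho> < 1" and x: "\<forall>i\<in>I. norm (x i) = 1"
  shows "peel_fun t \<alpha> Y I l p x holomorphic_on cball 0 \<rho>"
proof -
  have nY: "norm y = 1" if "y \<in> Y" for y using Y that by auto
  have *: "norm t * norm u < 1" if "norm u \<le> \<rho>" for u :: complex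
    using \<rho>(2) that mult_left_mono[OF that, of "norm t"] by auto
  have ne: "1 - t * y * u \<noteq> 0" if "norm y = 1" "u \<in> cball 0 \<rho>" for y u
    using one_minus_nonzero[of t "y * u"] that *[of u] by (simp add: norm_mult mult.assoc)
  have ne2: "1 - t * u * y \<noteq> 0" if "norm y = 1" "u \<in> cball 0 \<rho>" for y u
    using ne[OF that] by (simp add: mult_ac)
  have ne3: "1 - t * u\<^sup>2 \<noteq> 0" if "u \<in> cball 0 \<rho>" for u
  proof -
    have "norm t * (norm u)\<^sup>2 \<le> norm t * \<rho>\<^sup>2" using that by (intro mult_left_mono power_mono) auto
    then show ?thesis using \<rho>(1) by (intro one_minus_nonzero) (simp add: norm_power)
  qed
  show ?thesis
    unfolding peel_fun_def [abs_def]
    by (intro holomorphic_intros ne3) (use ne ne2 nY x in \<open>auto simp: norm_inverse\<close>)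
qed

lemma peel_fun_bounded:
  assumes I: "finite I" and Y: "Y \<subseteq> {1, -1}" and t: "norm t < 1"
    and \<rho>: "\<rho> > 1" "norm t * \<rho>\<^sup>2 < 1" "norm t * \<rho> < 1"
    and X: "\<And>x i. x \<in> X \<Longrightarrow> i \<in> I \<Longrightarrow> norm (x i) = 1"
    and p: "\<And>x k. x \<in> X \<Longrightarrow> norm (coeff (p x) k) \<le> M"
  shows "\<exists>C. \<forall>x\<in>X. \<forall>u. norm u \<le> \<rho> \<longrightarrow> norm (peel_fun t \<alpha> Y I l (p x) x u) \<le> C"
proof -
  have fin: "finite Y" using Y by (auto intro: finite_subset)
  have finL: "finite (letters I Y)" using fin I by simp
  have nY: "norm y = 1" if "y \<in> Y" for y using Y that by auto
  let ?S = "X \<times> cball 0 \<rho>"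
  have nx: "norm (fst s i) = 1" if "s \<in> ?S" "i \<in> I" for s i using X that by (cases s) auto
  have nu: "norm (snd s) \<le> \<rho>" if "s \<in> ?S" for s using that by auto
  have 1: "unif_bounded ?S (\<lambda>s. fst s i)" "unif_bounded ?S (\<lambda>s. inverse (fst s i))" if "i \<in> I" for i
    by (rule unif_boundedI[of _ _ 1], simp add: nx that norm_inverse)+
  have 2: "unif_bounded ?S snd" by (rule unif_boundedI[OF nu])
  have tu: "norm t * norm u \<le> norm t * \<rho>" if "norm u \<le> \<rho>" for u :: complex
    using that by (rule mult_left_mono) simp
  have tu2: "norm t * (norm u)\<^sup>2 \<le> norm t * \<rho>\<^sup>2" if "norm u \<le> \<rho>" for u :: complex
    using that by (intro mult_left_mono power_mono) auto
  have 3: "bounded_away ?S (\<lambda>s. 1 - t * snd s * fst s i)" "bounded_away ?S (\<lambda>s. 1 - t * snd s * inverse (fst s i))"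
    if "i \<in> I" for i
    by (rule bounded_away_one_minus[OF \<rho>(3)], simp only: norm_mult norm_inverse nx that, simp add: tu nu)+
  have 4: "bounded_away ?S (\<lambda>s. 1 - t * y * snd s)" if "y \<in> Y" for y
    by (rule bounded_away_one_minus[OF \<rho>(3)]) (simp only: norm_mult nY that mult_1_right tu nu)
  have 5: "bounded_away ?S (\<lambda>s. 1 - t * (snd s)\<^sup>2)"
    by (rule bounded_away_one_minus[OF \<rho>(2)]) (simp only: norm_mult norm_power tu2 nu)
  have 6: "unif_bounded ?S (\<lambda>s. letter_val (fst s) a)" if "a \<in> letters I Y" for a
  proof (rule unif_boundedI)
    fix s assume s: "s \<in> ?S"
    have "norm (letter_val (fst s) a) = 1"
      by (rule norm_letter_val[OF _ Y that]) (use nx[OF s] in blast)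
    then show "norm (letter_val (fst s) a) \<le> 1" by simp
  qed
  have 7: "unif_bounded ?S (\<lambda>s. coeff (p (fst s)) k)" for k
    by (rule unif_boundedI[of _ _ M]) (use p in auto)
  have 8: "unif_bounded ?S (\<lambda>s. torus_weight t Y I (fst s))"
    by (rule torus_weight_bounded[OF I Y t]) (use nx in auto)
  have "unif_bounded ?S (\<lambda>s. peel_fun t \<alpha> Y I l (p (fst s)) (fst s) (snd s))"
    unfolding peel_fun_def
    by (intro unif_bounded_intros 1 2 3 4 5 6 7 8) (use I fin finL in auto)
  then show ?thesis by (fastforce simp: unif_bounded_def)
qed

text \<open>
  The radius and the bound are chosen before the point \<open>x\<close>. This uniformity makes the two terms of a
  pair integrable together, although each of them alone may be singular at \<open>x\<^sub>i = \<plusminus>1\<close>.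
\<close>

lemma hl_summand_pair_quotient_family:
  assumes I: "finite I" "i \<notin> I" and Y: "Y \<subseteq> {1, -1}" and t: "norm t < 1" and ls: "\<forall>k\<in>set ls. k \<le> l"
  obtains \<rho> M F where "\<rho> > 1"
    "\<And>x. generic_point I x \<Longrightarrow> F x holomorphic_on ball 0 \<rho>"
    "\<And>x. generic_point I x \<Longrightarrow> continuous_on (cball 0 \<rho>) (F x)"
    "\<And>x u. generic_point I x \<Longrightarrow> norm u \<le> \<rho> \<Longrightarrow> norm (F x u) \<le> M"
    "\<And>x u. generic_point I x \<Longrightarrow> norm u = 1 \<Longrightarrow> u \<notin> letter_val x ` letters I {1, -1} \<Longrightarrow>
       hl_summand t \<alpha> Y (insert i I) l ls (Var i) (x(i := u)) +
       hl_summand t \<alpha> Y (insert i I) l ls (Inv i) (x(i := u)) = antisym_quotient (F x) u"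
    "\<And>x. generic_point I x \<Longrightarrow> F x 1 - F x (-1) =
       (\<Sum>s\<in>{1, -1} - Y. residue_factor t \<alpha> Y l s * hl_integrand t \<alpha> (insert s Y) I ls x)"
proof -
  have fin: "finite Y" using Y by (auto intro: finite_subset)
  have finL: "finite (letters I Y)" using fin I by simp
  obtain \<rho> where \<rho>: "\<rho> > 1" "norm t * \<rho>\<^sup>2 < 1" "norm t * \<rho> < 1"
    using exists_radius[OF t] .
  have one: "\<forall>i\<in>I. norm (x i) = 1" if "generic_point I x" for x using that by (simp add: generic_point_def)
  obtain M where M: "\<And>z. inj_on z (letters I Y) \<Longrightarrow> (\<forall>a\<in>letters I Y. norm (z a) = 1) \<Longrightarrow>
    (\<exists>p. degree p \<le> l \<and>
      (\<forall>v. v \<notin> z ` letters I Y \<longrightarrow> hl_sum t ls (insert (Inv i) (letters I Y)) (z(Inv i := v)) = poly p v) \<and>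
      (\<forall>k. norm (coeff p k) \<le> M))"
    using hl_sum_polynomial_bounded[OF finL letters_not_mem(2)[OF I(2)] ls, of t] by blast
  have "\<exists>p. degree p \<le> l \<and>
      (\<forall>v. v \<notin> letter_val x ` letters I Y \<longrightarrow>
        hl_sum t ls (insert (Inv i) (letters I Y)) ((letter_val x)(Inv i := v)) = poly p v) \<and>
      (\<forall>k. norm (coeff p k) \<le> M)" if x: "generic_point I x" for x
  proof (rule M)
    show "inj_on (letter_val x) (letters I Y)"
      using letters_mono[OF Y] x by (auto simp: generic_point_def intro: inj_on_subset)
    show "\<forall>a\<in>letters I Y. norm (letter_val x a) = 1"
      using norm_letter_val[OF one[OF x] Y] by blast
  qed
  then obtain p where p: "\<And>x. generic_point I x \<Longrightarrow> degree (p x) \<le> l"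
    "\<And>x v. generic_point I x \<Longrightarrow> v \<notin> letter_val x ` letters I Y \<Longrightarrow>
        hl_sum t ls (insert (Inv i) (letters I Y)) ((letter_val x)(Inv i := v)) = poly (p x) v"
    "\<And>x k. generic_point I x \<Longrightarrow> norm (coeff (p x) k) \<le> M"
    by metis
  define F where "F x = peel_fun t \<alpha> Y I l (p x) x" for x
  have "\<exists>C. \<forall>x\<in>{x. generic_point I x}. \<forall>u. norm u \<le> \<rho> \<longrightarrow> norm (peel_fun t \<alpha> Y I l (p x) x u) \<le> C"
    by (rule peel_fun_bounded[OF I(1) Y t \<rho>, where M = M]) (use one p in auto)
  then obtain C where C: "\<And>x u. generic_point I x \<Longrightarrow> norm u \<le> \<rho> \<Longrightarrow> norm (F x u) \<le> C"
    unfolding F_def by blast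
  have hol: "F x holomorphic_on cball 0 \<rho>" if "generic_point I x" for x
    unfolding F_def by (rule peel_fun_holomorphic[OF Y \<rho>(2,3) one[OF that]])
  show thesis
  proof (rule that[of \<rho> F C])
    fix x assume x: "generic_point I x"
    show "F x holomorphic_on ball 0 \<rho>" using hol[OF x] by (rule holomorphic_on_subset) auto
    show "continuous_on (cball 0 \<rho>) (F x)" using hol[OF x] by (rule holomorphic_on_imp_continuous_on)
    show "norm (F x u) \<le> C" if "norm u \<le> \<rho>" for u using C x that by blast
    show "hl_summand t \<alpha> Y (insert i I) l ls (Var i) (x(i := u)) +
       hl_summand t \<alpha> Y (insert i I) l ls (Inv i) (x(i := u)) = antisym_quotient (F x) u"
      if "norm u = 1" "u \<notin> letter_val x ` letters I {1, -1}" for u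
      unfolding F_def by (rule hl_summand_pair_eq_quotient[OF I Y t that one[OF x] p(1,2)[OF x]])
    have val: "F x s = (if s \<in> Y then 0 else s * residue_factor t \<alpha> Y l s * hl_integrand t \<alpha> (insert s Y) I ls x)"
      if "s \<in> {1, -1}" for s
    proof (cases "s \<in> Y")
      case True
      then show ?thesis unfolding F_def using peel_fun_sign_in[OF fin True that] by simp
    next
      case False
      then show ?thesis
        unfolding F_def using peel_fun_sign_notin[OF I Y that False x p(1,2)[OF x]] by simp
    qed
    have "(\<Sum>s\<in>{1, -1} - Y. residue_factor t \<alpha> Y l s * hl_integrand t \<alpha> (insert s Y) I ls x) =
      (\<Sum>s\<in>{1, -1}. if s \<in> Y then 0 else residue_factor t \<alpha> Y l s * hl_integrand t \<alpha> (insert s Y) I ls x)"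
      by (intro sum.mono_neutral_cong_left) auto
    then show "F x 1 - F x (-1) =
       (\<Sum>s\<in>{1, -1} - Y. residue_factor t \<alpha> Y l s * hl_integrand t \<alpha> (insert s Y) I ls x)"
      using val[of 1] val[of "-1"] by auto
  qed (use \<rho> in auto)
qed

section \<open>The recursion for the integrals\<close>

lemma generic_point_insert:
  assumes i: "i \<notin> I"
  shows "generic_point (insert i I) (x(i := u)) \<longleftrightarrow>
    generic_point I x \<and> norm u = 1 \<and> u \<notin> letter_val x ` letters I {1, -1}"
proof -
  let ?L = "letters I {1, -1}" and ?z = "letter_val (x(i := u))"
  have nm: "Var i \<notin> ?L" "Inv i \<notin> ?L" using letters_not_mem[OF i] by auto
  have z: "?z a = letter_val x a" if "a \<in> ?L" for a using letter_val_upd[OF i that] .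
  have img: "?z ` ?L = letter_val x ` ?L" using z by (auto simp: image_iff)
  have inj: "inj_on ?z ?L = inj_on (letter_val x) ?L" using z by (auto simp: inj_on_def)
  have nrm: "(\<forall>j\<in>insert i I. norm ((x(i := u)) j) = 1) \<longleftrightarrow> (\<forall>j\<in>I. norm (x j) = 1) \<and> norm u = 1"
    using i by auto
  have "inj_on ?z (letters (insert i I) {1, -1}) \<longleftrightarrow>
    inj_on (letter_val x) ?L \<and> inverse u \<notin> letter_val x ` ?L \<and> u \<noteq> inverse u \<and> u \<notin> letter_val x ` ?L"
    unfolding letters_insert using nm by (simp add: inj img)
  moreover have "u \<notin> letter_val x ` ?L \<Longrightarrow> norm u = 1 \<Longrightarrow> u \<noteq> inverse u"
    using sign_mem_letter_values circle_neq_inverse by blast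
  ultimately show ?thesis
    unfolding generic_point_def nrm using letter_values_inverse_closed by blast
qed

abbreviation torus_measure :: "nat set \<Rightarrow> (nat \<Rightarrow> real) measure" where
  "torus_measure I \<equiv> PiM I (\<lambda>_. circle_measure)"

abbreviation torus_point :: "(nat \<Rightarrow> real) \<Rightarrow> nat \<Rightarrow> complex" where
  "torus_point \<theta> \<equiv> \<lambda>j. cis (\<theta> j)"

lemma product_prob_space_circle: "product_prob_space (\<lambda>_. circle_measure)"
proof -
  interpret prob_space circle_measure by (rule prob_space_circle_measure)
  show ?thesis by unfold_locales
qed

lemma prob_space_torus_measure: "prob_space (torus_measure I)"
  by (intro prob_space_PiM prob_space_circle_measure)

lemma torus_point_upd: "torus_point (\<theta>(i := y)) = (torus_point \<theta>)(i := cis y)"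
  by (auto simp: fun_eq_iff)

lemma measurable_torus_point:
  assumes "i \<in> I"
  shows "(\<lambda>\<theta>. torus_point \<theta> i) \<in> borel_measurable (torus_measure I)"
proof -
  have "(\<lambda>\<theta>. \<theta> i) \<in> measurable (torus_measure I) circle_measure"
    using assms by (rule measurable_component_singleton)
  then have "(\<lambda>\<theta>. \<theta> i) \<in> borel_measurable (torus_measure I)"
    by (simp only: measurable_cong_sets[OF refl sets_circle_measure])
  then show ?thesis by (rule measurable_compose[OF _ measurable_cis])
qed

lemma measurable_letter_val:
  assumes "a \<in> letters I Y"
  shows "(\<lambda>\<theta>. letter_val (torus_point \<theta>) a) \<in> borel_measurable (torus_measure I)"
proof (cases a)
  case (Var i)
  then show ?thesis using assms measurable_torus_point[of i I] by (auto simp: letters_def)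
next
  case (Inv i)
  then have "i \<in> I" using assms by (auto simp: letters_def)
  then have "(\<lambda>\<theta>. inverse (torus_point \<theta> i)) \<in> borel_measurable (torus_measure I)"
    by (intro borel_measurable_inverse measurable_torus_point)
  then show ?thesis using Inv by (simp del: cis_inverse)
next
  case (Fix y)
  then show ?thesis by simp
qed

lemma measurable_hl_sum:
  assumes "\<And>a. a \<in> A \<Longrightarrow> (\<lambda>\<omega>. z \<omega> a) \<in> borel_measurable M"
  shows "(\<lambda>\<omega>. hl_sum t ls A (z \<omega>)) \<in> borel_measurable M"
  using assms
proof (induction ls arbitrary: A)
  case (Cons l ls)
  show ?case
    unfolding hl_sum.simps hl_kernel_def
    by (intro borel_measurable_sum borel_measurable_times borel_measurable_prod borel_measurable_power
        borel_measurable_divide borel_measurable_diff Cons.IH) (use Cons.prems in auto)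
qed simp

lemma measurable_torus_weight:
  "(\<lambda>\<theta>. torus_weight t Y I (torus_point \<theta>)) \<in> borel_measurable (torus_measure I)"
  unfolding torus_weight_def var_weight_def pair_weight_def one_minus_pm_def one_minus_pm2_def
  by (intro borel_measurable_sum borel_measurable_times borel_measurable_prod borel_measurable_power
      borel_measurable_divide borel_measurable_diff borel_measurable_inverse measurable_torus_point
      borel_measurable_const) auto

lemma measurable_hl_integrand:
  "(\<lambda>\<theta>. hl_integrand t \<alpha> Y I ls (torus_point \<theta>)) \<in> borel_measurable (torus_measure I)"
  unfolding hl_integrand_def
  by (intro borel_measurable_times borel_measurable_prod borel_measurable_diff borel_measurable_const
      measurable_hl_sum measurable_torus_weight measurable_letter_val)

lemma measurable_hl_summand:
  assumes "a \<in> letters I Y"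
  shows "(\<lambda>\<theta>. hl_summand t \<alpha> Y I l ls a (torus_point \<theta>)) \<in> borel_measurable (torus_measure I)"
  unfolding hl_summand_def hl_kernel_def
  by (intro borel_measurable_times borel_measurable_prod borel_measurable_diff borel_measurable_const
      borel_measurable_power borel_measurable_divide measurable_hl_sum measurable_torus_weight
      measurable_letter_val[where Y = Y]) (use assms in auto)

lemma measurable_generic_point:
  assumes "finite I"
  shows "{\<theta> \<in> space (torus_measure I). \<not> generic_point I (torus_point \<theta>)} \<in> sets (torus_measure I)"
proof -
  have "{\<theta> \<in> space (torus_measure I). \<not> generic_point I (torus_point \<theta>)} =
    (\<Union>(a, b)\<in>{(a, b). a \<in> letters I {1, -1} \<and> b \<in> letters I {1, -1} \<and> a \<noteq> b}.
      {\<theta> \<in> space (torus_measure I). letter_val (torus_point \<theta>) a = letter_val (torus_point \<theta>) b})"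
    by (auto simp: generic_point_def inj_on_def)
  also have "\<dots> \<in> sets (torus_measure I)"
  proof (rule sets.finite_UN)
    show "finite {(a, b). a \<in> letters I {1, -1} \<and> b \<in> letters I {1, -1} \<and> a \<noteq> b}"
      by (rule finite_subset[of _ "letters I {1, -1} \<times> letters I {1, -1}"]) (use assms in auto)
    fix p assume p: "p \<in> {(a, b). a \<in> letters I {1, -1} \<and> b \<in> letters I {1, -1} \<and> a \<noteq> b}"
    obtain a b where ab: "p = (a, b)" by fastforce
    let ?d = "\<lambda>\<theta>. letter_val (torus_point \<theta>) a - letter_val (torus_point \<theta>) b"
    have "?d \<in> borel_measurable (torus_measure I)"
      using p ab by (intro borel_measurable_diff measurable_letter_val[where Y = "{1, -1}"]) auto
    then have "?d -` {0} \<inter> space (torus_measure I) \<in> sets (torus_measure I)"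
      by (rule measurable_sets) simp
    also have "?d -` {0} \<inter> space (torus_measure I) =
      {\<theta> \<in> space (torus_measure I). letter_val (torus_point \<theta>) a = letter_val (torus_point \<theta>) b}"
      by auto
    finally show "(case p of (a, b) \<Rightarrow> {\<theta> \<in> space (torus_measure I).
        letter_val (torus_point \<theta>) a = letter_val (torus_point \<theta>) b}) \<in> sets (torus_measure I)"
      by (simp add: ab)
  qed
  finally show ?thesis .
qed

text \<open>
  When a variable is added, for every generic choice of the others only finitely many of its values
  are forbidden.
\<close>

lemma AE_generic_point:
  assumes "finite I"
  shows "AE \<theta> in torus_measure I. generic_point I (torus_point \<theta>)"
  using assms
proof (induction I rule: finite_induct)
  case empty
  then show ?case by (auto simp: generic_point_def letters_def inj_on_def)
next
  case (insert i I)
  interpret product_prob_space "\<lambda>_. circle_measure" "insert i I" by (rule product_prob_space_circle)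
  define B where "B = {\<theta> \<in> space (torus_measure (insert i I)). \<not> generic_point (insert i I) (torus_point \<theta>)}"
  have B: "B \<in> sets (torus_measure (insert i I))"
    unfolding B_def using insert.hyps by (intro measurable_generic_point) auto
  have "emeasure (torus_measure (insert i I)) B =
    (\<integral>\<^sup>+ \<theta>. (\<integral>\<^sup>+ y. indicator B (\<theta>(i := y)) \<partial>circle_measure) \<partial>torus_measure I)"
    using B insert.hyps by (subst product_nn_integral_insert[symmetric]) auto
  also have "\<dots> = (\<integral>\<^sup>+ \<theta>. 0 \<partial>torus_measure I)"
  proof (rule nn_integral_cong_AE)
    show "AE \<theta> in torus_measure I. (\<integral>\<^sup>+ y. indicator B (\<theta>(i := y)) \<partial>circle_measure) = 0"
      using insert.IH
    proof eventually_elim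
      case (elim \<theta>)
      have "AE y in circle_measure. cis y \<notin> letter_val (torus_point \<theta>) ` letters I {1, -1}"
        using insert.hyps by (intro AE_circle_measure_notin_finite) auto
      then have "AE y in circle_measure. indicator B (\<theta>(i := y)) = (0 :: ennreal)"
      proof eventually_elim
        case (elim y)
        then have "generic_point (insert i I) (torus_point (\<theta>(i := y)))"
          unfolding torus_point_upd generic_point_insert[OF insert.hyps(2)]
          using \<open>generic_point I (torus_point \<theta>)\<close> by simp
        then show ?case by (simp add: B_def)
      qed
      then have "(\<integral>\<^sup>+ y. indicator B (\<theta>(i := y)) \<partial>circle_measure) = (\<integral>\<^sup>+ y. 0 \<partial>circle_measure)"
        by (rule nn_integral_cong_AE)
      then show ?case by simp
    qed
  qed
  finally have "emeasure (torus_measure (insert i I)) B = 0" by simp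
  then show ?case using B by (intro AE_I[of _ _ B]) (auto simp: B_def)
qed

definition hl_integral :: "complex \<Rightarrow> complex \<Rightarrow> complex set \<Rightarrow> nat set \<Rightarrow> nat list \<Rightarrow> complex" where
  "hl_integral t \<alpha> Y I ls = (LINT \<theta>|torus_measure I. hl_integrand t \<alpha> Y I ls (torus_point \<theta>))"

lemma integrable_hl_integrand:
  assumes "finite I" "Y \<subseteq> {1, -1}" "norm t < 1"
  shows "integrable (torus_measure I) (\<lambda>\<theta>. hl_integrand t \<alpha> Y I ls (torus_point \<theta>))"
proof -
  interpret prob_space "torus_measure I" by (rule prob_space_torus_measure)
  obtain C where "\<And>x. generic_point I x \<Longrightarrow> norm (hl_integrand t \<alpha> Y I ls x) \<le> C"
    using hl_integrand_bounded[OF assms, of \<alpha> ls] by blast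
  then show ?thesis
    using AE_generic_point[OF assms(1)]
    by (intro integrable_const_bound[where B = C] measurable_hl_integrand) (auto elim: eventually_mono)
qed

lemma integral_hl_summand_pair:
  fixes \<alpha> :: complex
  assumes I: "finite I" "i \<notin> I" and Y: "Y \<subseteq> {1, -1}" and t: "norm t < 1" and ls: "\<forall>k\<in>set ls. k \<le> l"
  defines "T \<equiv> \<lambda>x. hl_summand t \<alpha> Y (insert i I) l ls (Var i) x + hl_summand t \<alpha> Y (insert i I) l ls (Inv i) x"
  shows "integrable (torus_measure (insert i I)) (\<lambda>\<theta>. T (torus_point \<theta>))"
    and "(LINT \<theta>|torus_measure (insert i I). T (torus_point \<theta>)) =
      1 / 2 * (\<Sum>s\<in>{1, -1} - Y. residue_factor t \<alpha> Y l s * hl_integral t \<alpha> (insert s Y) I ls)"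
proof -
  interpret product_prob_space "\<lambda>_. circle_measure" "insert i I" by (rule product_prob_space_circle)
  obtain \<rho> M F where \<rho>: "\<rho> > 1"
    and F: "\<And>x. generic_point I x \<Longrightarrow> F x holomorphic_on ball 0 \<rho>"
    "\<And>x. generic_point I x \<Longrightarrow> continuous_on (cball 0 \<rho>) (F x)"
    "\<And>x u. generic_point I x \<Longrightarrow> norm u \<le> \<rho> \<Longrightarrow> norm (F x u) \<le> M"
    and T: "\<And>x u. generic_point I x \<Longrightarrow> norm u = 1 \<Longrightarrow> u \<notin> letter_val x ` letters I {1, -1} \<Longrightarrow>
       T (x(i := u)) = antisym_quotient (F x) u"
    and val: "\<And>x. generic_point I x \<Longrightarrow> F x 1 - F x (-1) =
       (\<Sum>s\<in>{1, -1} - Y. residue_factor t \<alpha> Y l s * hl_integrand t \<alpha> (insert s Y) I ls x)"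
    unfolding T_def by (rule hl_summand_pair_quotient_family[OF I Y t ls, of \<alpha>]) blast
  have meas: "(\<lambda>\<theta>. T (torus_point \<theta>)) \<in> borel_measurable (torus_measure (insert i I))"
    unfolding T_def
    by (intro borel_measurable_add measurable_hl_summand) (auto simp: letters_def)
  have bound: "norm (T x) \<le> M * quotient_bound \<rho>" if x: "generic_point (insert i I) x" for x
  proof -
    have "x = x(i := x i)" by simp
    then have "generic_point I x \<and> norm (x i) = 1 \<and> x i \<notin> letter_val x ` letters I {1, -1}"
      using x generic_point_insert[OF I(2), of x "x i"] by metis
    then have x': "generic_point I x" "norm (x i) = 1" "x i \<notin> letter_val x ` letters I {1, -1}" by auto
    then have "x i \<noteq> 1" "x i \<noteq> -1" using sign_mem_letter_values[of _ x I] by auto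
    then have "norm (antisym_quotient (F x) (x i)) \<le> M * quotient_bound \<rho>"
      using antisym_quotient_bound[OF F(1,2)[OF x'(1)] \<rho> F(3)[OF x'(1)] x'(2)] by blast
    then show ?thesis using T[OF x'] by simp
  qed
  show int: "integrable (torus_measure (insert i I)) (\<lambda>\<theta>. T (torus_point \<theta>))"
  proof -
    interpret P: prob_space "torus_measure (insert i I)" by (rule prob_space_torus_measure)
    have "AE \<theta> in torus_measure (insert i I). norm (T (torus_point \<theta>)) \<le> M * quotient_bound \<rho>"
      using AE_generic_point[of "insert i I"] I(1) bound by (auto elim: eventually_mono)
    then show ?thesis by (rule P.integrable_const_bound) (rule meas)
  qed
  have "(LINT \<theta>|torus_measure (insert i I). T (torus_point \<theta>)) =
    (LINT \<theta>|torus_measure I. LINT y|circle_measure. T (torus_point (\<theta>(i := y))))"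
    by (rule product_integral_insert[OF I int])
  also have "\<dots> = (LINT \<theta>|torus_measure I. 1 / 2 *
    (\<Sum>s\<in>{1, -1} - Y. residue_factor t \<alpha> Y l s * hl_integrand t \<alpha> (insert s Y) I ls (torus_point \<theta>)))"
  proof (rule integral_cong_AE)
    have "(\<lambda>p. T (torus_point (case p of (\<theta>, y) \<Rightarrow> \<theta>(i := y)))) \<in>
      borel_measurable (torus_measure I \<Otimes>\<^sub>M circle_measure)"
      by (rule measurable_compose[OF measurable_add_dim meas])
    then show "(\<lambda>\<theta>. LINT y|circle_measure. T (torus_point (\<theta>(i := y)))) \<in> borel_measurable (torus_measure I)"
      by (intro sigma_finite_measure.borel_measurable_lebesgue_integral
          prob_space_imp_sigma_finite prob_space_circle_measure) (simp add: case_prod_beta')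
    show "(\<lambda>\<theta>. 1 / 2 * (\<Sum>s\<in>{1, -1} - Y. residue_factor t \<alpha> Y l s *
        hl_integrand t \<alpha> (insert s Y) I ls (torus_point \<theta>))) \<in> borel_measurable (torus_measure I)"
      by (intro borel_measurable_times borel_measurable_sum borel_measurable_const measurable_hl_integrand)
    show "AE \<theta> in torus_measure I. (LINT y|circle_measure. T (torus_point (\<theta>(i := y)))) =
      1 / 2 * (\<Sum>s\<in>{1, -1} - Y. residue_factor t \<alpha> Y l s *
        hl_integrand t \<alpha> (insert s Y) I ls (torus_point \<theta>))"
      using AE_generic_point[OF I(1)] AE_space
    proof eventually_elim
      case (elim \<theta>)
      note generic = elim(1)
      let ?x = "torus_point \<theta>"
      have notin: "AE y in circle_measure. cis y \<notin> letter_val ?x ` letters I {1, -1}"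
        using I(1) by (intro AE_circle_measure_notin_finite) auto
      have "(LINT y|circle_measure. T (torus_point (\<theta>(i := y)))) =
        (LINT y|circle_measure. antisym_quotient (F ?x) (cis y))"
      proof (rule integral_cong_AE)
        show "AE y in circle_measure. T (torus_point (\<theta>(i := y))) = antisym_quotient (F ?x) (cis y)"
          using notin
        proof eventually_elim
          case (elim y)
          show ?case unfolding torus_point_upd by (rule T[OF generic _ elim]) simp
        qed
        show "(\<lambda>y. T (torus_point (\<theta>(i := y)))) \<in> borel_measurable circle_measure"
          by (rule measurable_compose[OF measurable_component_update[OF elim(2) I(2)] meas])
        show "(\<lambda>y. antisym_quotient (F ?x) (cis y)) \<in> borel_measurable circle_measure"
          by (rule measurable_antisym_quotient[OF F(1,2)[OF generic] \<rho> F(3)[OF generic]])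
      qed
      also have "\<dots> = (F ?x 1 - F ?x (-1)) / 2"
        by (rule integral_antisym_quotient[OF F(1,2)[OF generic] \<rho> F(3)[OF generic]])
      finally show ?case unfolding val[OF generic] by simp
    qed
  qed
  also have "\<dots> = 1 / 2 * (\<Sum>s\<in>{1, -1} - Y. residue_factor t \<alpha> Y l s * hl_integral t \<alpha> (insert s Y) I ls)"
  proof -
    have int: "integrable (torus_measure I) (\<lambda>\<theta>. hl_integrand t \<alpha> (insert s Y) I ls (torus_point \<theta>))"
      if "s \<in> {1, -1} - Y" for s
      using that Y by (intro integrable_hl_integrand I t) auto
    show ?thesis
      unfolding hl_integral_def
      by (subst integral_mult_right_zero, subst Bochner_Integration.integral_sum)
        (auto intro!: integrable_mult_right int)
  qed
  finally show "(LINT \<theta>|torus_measure (insert i I). T (torus_point \<theta>)) =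
      1 / 2 * (\<Sum>s\<in>{1, -1} - Y. residue_factor t \<alpha> Y l s * hl_integral t \<alpha> (insert s Y) I ls)" .
qed

text \<open>
  Freezing \<open>x\<^sub>i\<close> at \<open>s\<close> contributes for each \<open>i\<close>, so the second sum grows with the number of variables;
  this is where the factorial in \<open>torus_const\<close> comes from.
\<close>

lemma hl_integral_Cons:
  assumes I: "finite I" and Y: "Y \<subseteq> {1, -1}" and t: "norm t < 1" and ls: "\<forall>k\<in>set ls. k \<le> l"
  shows "hl_integral t \<alpha> Y I (l # ls) =
    (\<Sum>y\<in>Y. y ^ l * (1 - \<alpha> * y) * (\<Prod>d\<in>Y - {y}. hl_kernel t y d) * hl_integral t \<alpha> (Y - {y}) I ls) +
    (\<Sum>i\<in>I. 1 / 2 * (\<Sum>s\<in>{1, -1} - Y. residue_factor t \<alpha> Y l s * hl_integral t \<alpha> (insert s Y) (I - {i}) ls))"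
proof -
  have fin: "finite Y" using Y by (auto intro: finite_subset)
  define c where "c y = y ^ l * (1 - \<alpha> * y) * (\<Prod>d\<in>Y - {y}. hl_kernel t y d)" for y
  define T where "T i x = hl_summand t \<alpha> Y I l ls (Var i) x + hl_summand t \<alpha> Y I l ls (Inv i) x" for i x
  have ins: "insert i (I - {i}) = I" if "i \<in> I" for i using that by auto
  have T: "integrable (torus_measure I) (\<lambda>\<theta>. T i (torus_point \<theta>))"
    "(LINT \<theta>|torus_measure I. T i (torus_point \<theta>)) =
      1 / 2 * (\<Sum>s\<in>{1, -1} - Y. residue_factor t \<alpha> Y l s * hl_integral t \<alpha> (insert s Y) (I - {i}) ls)"
    if i: "i \<in> I" for i
    using integral_hl_summand_pair[of "I - {i}" i, OF _ _ Y t ls, of \<alpha>] I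
    unfolding ins[OF i] T_def by auto
  have int: "integrable (torus_measure I) (\<lambda>\<theta>. hl_integrand t \<alpha> (Y - {y}) I ls (torus_point \<theta>))" for y
    using Y by (intro integrable_hl_integrand I t) auto
  have "hl_integral t \<alpha> Y I (l # ls) = (LINT \<theta>|torus_measure I.
    (\<Sum>y\<in>Y. c y * hl_integrand t \<alpha> (Y - {y}) I ls (torus_point \<theta>)) + (\<Sum>i\<in>I. T i (torus_point \<theta>)))"
    unfolding hl_integral_def
  proof (rule integral_cong_AE)
    show "AE \<theta> in torus_measure I. hl_integrand t \<alpha> Y I (l # ls) (torus_point \<theta>) =
      (\<Sum>y\<in>Y. c y * hl_integrand t \<alpha> (Y - {y}) I ls (torus_point \<theta>)) + (\<Sum>i\<in>I. T i (torus_point \<theta>))"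
      using AE_generic_point[OF I]
    proof eventually_elim
      case (elim \<theta>)
      show ?case
        unfolding hl_integrand_Cons[OF I fin] T_def c_def
        using hl_summand_Fix[OF I elim Y _ t] by simp
    qed
    show "(\<lambda>\<theta>. (\<Sum>y\<in>Y. c y * hl_integrand t \<alpha> (Y - {y}) I ls (torus_point \<theta>)) +
        (\<Sum>i\<in>I. T i (torus_point \<theta>))) \<in> borel_measurable (torus_measure I)"
      by (intro borel_measurable_add borel_measurable_sum borel_measurable_times borel_measurable_const
          measurable_hl_integrand borel_measurable_integrable[OF T(1)])
  qed (rule measurable_hl_integrand)
  also have "\<dots> = (\<Sum>y\<in>Y. c y * hl_integral t \<alpha> (Y - {y}) I ls) +
      (\<Sum>i\<in>I. LINT \<theta>|torus_measure I. T i (torus_point \<theta>))"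
    unfolding hl_integral_def using int T(1)
    by (subst Bochner_Integration.integral_add)
      (auto simp: Bochner_Integration.integral_sum intro!: Bochner_Integration.integrable_sum)
  finally show ?thesis by (simp add: c_def T(2))
qed

section \<open>Solution of the recursion\<close>

definition component_const :: "complex \<Rightarrow> complex set \<Rightarrow> complex" where
  "component_const t Y = (if card Y = 0 then 1 / 2 else if card Y = 1 then 1 else 1 + t)"

definition torus_const :: "complex \<Rightarrow> nat \<Rightarrow> complex" where
  "torus_const t m = (2 / (1 - t)) ^ m * fact m"

lemma torus_const_pred:
  assumes "norm t < 1" "m > 0"
  shows "of_nat m * torus_const t (m - 1) = torus_const t m * (1 - t) / 2"
proof -
  have "1 - t \<noteq> 0" using assms by auto
  then show ?thesis
    using assms(2) by (cases m) (simp_all add: torus_const_def field_simps)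
qed

text \<open>
  With \<open>\<sigma> = 1\<close> if \<open>-1 \<notin> Y\<close> and \<open>\<sigma> = -1\<close> otherwise this is the dependence of the integral on the
  partition.
\<close>

definition parity_sum :: "complex \<Rightarrow> complex \<Rightarrow> nat list \<Rightarrow> complex" where
  "parity_sum \<alpha> \<sigma> ls = (- \<alpha>) ^ length (filter odd ls) + \<sigma> * (- \<alpha>) ^ length (filter even ls)"

text \<open>
  Prepending a part multiplies one of the two powers of \<open>-\<alpha>\<close> by \<open>-\<alpha>\<close>; which one is decided by the
  sign \<open>(-1)^l\<close>, and the combination with the factors \<open>1 \<mp> \<alpha>\<close> picks it out.
\<close>

lemma parity_sum_Cons:
  "(1 - \<alpha>) * parity_sum \<alpha> 1 ls + (-1) ^ l * (1 + \<alpha>) * parity_sum \<alpha> (-1) ls = 2 * parity_sum \<alpha> 1 (l # ls)"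
  "(1 - \<alpha>) * parity_sum \<alpha> (-1) ls + (-1) ^ l * (1 + \<alpha>) * parity_sum \<alpha> 1 ls = 2 * parity_sum \<alpha> (-1) (l # ls)"
  by (cases "even l"; simp add: parity_sum_def algebra_simps)+

text \<open>
  The coefficients of the recursion match those of \<open>parity_sum_Cons\<close> once the constants are
  inserted. The only exception is \<open>I = {}\<close> with a single fixed letter, where the second sum is
  empty; but then the list is exhausted after this step, and the missing term would vanish.
\<close>

lemma hl_integral_eval:
  assumes "finite I" "Y \<subseteq> {1, -1}" "norm t < 1" "sorted_wrt (\<ge>) ls" "length ls = 2 * card I + card Y"
  shows "hl_integral t \<alpha> Y I ls =
    component_const t Y * torus_const t (card I) * parity_sum \<alpha> (if -1 \<in> Y then -1 else 1) ls"
  using assms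
proof (induction ls arbitrary: I Y)
  case Nil
  then have "I = {}" and "finite Y" by (auto intro: finite_subset)
  with Nil have e: "I = {}" "Y = {}" by auto
  interpret prob_space "torus_measure {}" by (rule prob_space_torus_measure)
  have "hl_integral t \<alpha> {} {} [] = 1"
    using prob_space by (simp add: hl_integral_def hl_integrand_def torus_weight_def letters_def)
  then show ?case by (simp add: e component_const_def torus_const_def parity_sum_def)
next
  case (Cons l ls)
  note I = Cons.prems(1) and Y = Cons.prems(2) and t = Cons.prems(3)
  have ls: "\<forall>k\<in>set ls. k \<le> l" "sorted_wrt (\<ge>) ls" using Cons.prems(4) by auto
  have nz: "1 - t \<noteq> 0" "1 + t \<noteq> 0"
    using t one_minus_nonzero[of t 1] one_minus_nonzero[of t "-1"] by auto
  define m where "m = card I"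
  define A where "A = parity_sum \<alpha> 1 ls"
  define B where "B = parity_sum \<alpha> (-1) ls"
  have finY: "finite Y" using Y by (auto intro: finite_subset)
  have rem: "hl_integral t \<alpha> (Y - {y}) I ls = component_const t (Y - {y}) * torus_const t m *
      (if -1 \<in> Y - {y} then B else A)" if "y \<in> Y" for y
  proof -
    have "card Y > 0" using that finY by (auto simp: card_gt_0_iff)
    then have "length ls = 2 * card I + card (Y - {y})" "Y - {y} \<subseteq> {1, -1}"
      using Cons.prems(5) that Y by auto
    then show ?thesis
      using Cons.IH[OF I _ t ls(2), of "Y - {y}"] by (simp add: A_def B_def m_def)
  qed
  have ins: "hl_integral t \<alpha> (insert s Y) (I - {i}) ls =
      component_const t (insert s Y) * torus_const t (m - 1) * (if -1 \<in> insert s Y then B else A)"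
    if "s \<in> {1, -1} - Y" "i \<in> I" for s i
  proof -
    have "card (I - {i}) = m - 1" "card I > 0" using that I by (auto simp: m_def card_gt_0_iff)
    moreover have "insert s Y \<subseteq> {1, -1}" "card (insert s Y) = Suc (card Y)" using that Y finY by auto
    ultimately show ?thesis
      using Cons.IH[of "I - {i}" "insert s Y"] I t ls(2) Cons.prems(5) that
      by (auto simp: A_def B_def m_def)
  qed
  have "hl_integral t \<alpha> Y I (l # ls) =
    (\<Sum>y\<in>Y. y ^ l * (1 - \<alpha> * y) * (\<Prod>d\<in>Y - {y}. hl_kernel t y d) *
      (component_const t (Y - {y}) * torus_const t m * (if -1 \<in> Y - {y} then B else A))) +
    of_nat m * (1 / 2 * (\<Sum>s\<in>{1, -1} - Y. residue_factor t \<alpha> Y l s *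
      (component_const t (insert s Y) * torus_const t (m - 1) * (if -1 \<in> insert s Y then B else A))))"
    unfolding hl_integral_Cons[OF I Y t ls(1)] by (simp add: rem ins m_def)
  also have "\<dots> = (\<Sum>y\<in>Y. y ^ l * (1 - \<alpha> * y) * (\<Prod>d\<in>Y - {y}. hl_kernel t y d) *
      (component_const t (Y - {y}) * torus_const t m * (if -1 \<in> Y - {y} then B else A))) +
    (of_nat m * torus_const t (m - 1)) / 2 * (\<Sum>s\<in>{1, -1} - Y. residue_factor t \<alpha> Y l s *
      (component_const t (insert s Y) * (if -1 \<in> insert s Y then B else A)))"
    by (simp add: sum_distrib_left mult_ac)
  finally have rec: "hl_integral t \<alpha> Y I (l # ls) = \<dots>" .
  have Q: "of_nat m * torus_const t (m - 1) * c = torus_const t m * (1 - t) / 2 * c"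
    if "m > 0 \<or> c = 0" for c
  proof (cases "m > 0")
    case True
    then show ?thesis by (simp only: torus_const_pred[OF t])
  next
    case False
    then show ?thesis using that by simp
  qed
  have AB: "(1 - \<alpha>) * A + (-1) ^ l * (1 + \<alpha>) * B = 2 * parity_sum \<alpha> 1 (l # ls)"
    "(1 - \<alpha>) * B + (-1) ^ l * (1 + \<alpha>) * A = 2 * parity_sum \<alpha> (-1) (l # ls)"
    unfolding A_def B_def by (rule parity_sum_Cons)+
  have B0: "m > 0 \<or> B = 0" if "card Y = 1"
  proof (cases "m > 0")
    case False
    then have "ls = []" using Cons.prems(5) that by (simp add: m_def)
    then show ?thesis by (simp add: B_def parity_sum_def)
  qed simp
  have cancel: "x / e * (2 / d) * (d * b) = b * (x * 2 / e)" if "d \<noteq> 0" for x e d b :: complex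
    using that by simp
  have halve: "a * d / 2 * b * (x / d) = a / 2 * (x * b)" if "d \<noteq> 0" for a d b x :: complex
    using that by simp
  have double: "a / 2 * (b * (x * 2 / e)) = a * b * (x / e)" for a b x e :: complex
    by simp
  consider "Y = {}" | "Y = {1}" | "Y = {-1}" | "Y = {1, -1}" using Y by blast
  then show ?case
  proof cases
    case 1
    then have "m > 0" using Cons.prems(5) by (auto simp: m_def)
    have S: "(\<Sum>s\<in>{1, -1} - Y. residue_factor t \<alpha> Y l s *
        (component_const t (insert s Y) * (if -1 \<in> insert s Y then B else A))) =
      2 * parity_sum \<alpha> 1 (l # ls) / (1 - t)"
      unfolding AB(1)[symmetric] by (simp add: 1 residue_factor_def component_const_def add_divide_distrib)
    have "hl_integral t \<alpha> Y I (l # ls) =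
      of_nat m * torus_const t (m - 1) * (parity_sum \<alpha> 1 (l # ls) / (1 - t))"
      unfolding rec S by (simp add: 1)
    also have "\<dots> = torus_const t m * (1 - t) / 2 * (parity_sum \<alpha> 1 (l # ls) / (1 - t))"
      by (rule Q) (simp add: \<open>m > 0\<close>)
    also have "\<dots> = torus_const t m / 2 * parity_sum \<alpha> 1 (l # ls)"
    proof -
      have "a * d / 2 * (p / d) = a / 2 * p" if "d \<noteq> 0" for a d p :: complex
        using that by simp
      then show ?thesis using nz by blast
    qed
    finally show ?thesis
      by (simp add: 1 component_const_def flip: m_def)
  next
    case 2
    have S: "(\<Sum>s\<in>{1, -1} - Y. residue_factor t \<alpha> Y l s *
        (component_const t (insert s Y) * (if -1 \<in> insert s Y then B else A))) =
      B * ((-1) ^ l * (1 + \<alpha>) * 2 / (1 - t))"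
    proof -
      have "residue_factor t \<alpha> {1} l (-1) = (-1) ^ l * (1 + \<alpha>) / (1 - t) * (2 / (1 + t))"
        by (simp add: residue_factor_def)
      then show ?thesis
        using cancel[OF nz(2)] nz by (simp add: 2 component_const_def)
    qed
    have "hl_integral t \<alpha> Y I (l # ls) =
      torus_const t m / 2 * ((1 - \<alpha>) * A) + of_nat m * torus_const t (m - 1) * B * ((-1) ^ l * (1 + \<alpha>) / (1 - t))"
      unfolding rec S double by (simp add: 2 component_const_def mult_ac)
    also have "\<dots> = torus_const t m / 2 * ((1 - \<alpha>) * A + (-1) ^ l * (1 + \<alpha>) * B)"
    proof -
      have "m > 0 \<or> B = 0" using B0 2 by simp
      then show ?thesis
        unfolding Q[OF \<open>m > 0 \<or> B = 0\<close>] halve[OF nz(1)] by (simp only: distrib_left add.commute)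
    qed
    finally show ?thesis unfolding AB(1) by (simp add: 2 component_const_def flip: m_def)
  next
    case 3
    have d: "{1, -1} - {-1} = {1 :: complex}" by auto
    have S: "(\<Sum>s\<in>{1, -1} - Y. residue_factor t \<alpha> Y l s *
        (component_const t (insert s Y) * (if -1 \<in> insert s Y then B else A))) =
      B * ((1 - \<alpha>) * 2 / (1 - t))"
    proof -
      have "residue_factor t \<alpha> {-1} l 1 = (1 - \<alpha>) / (1 - t) * (2 / (1 + t))"
        by (simp add: residue_factor_def)
      then show ?thesis
        using cancel[OF nz(2)] nz by (simp add: 3 d component_const_def)
    qed
    have "hl_integral t \<alpha> Y I (l # ls) =
      torus_const t m / 2 * ((-1) ^ l * (1 + \<alpha>) * A) + of_nat m * torus_const t (m - 1) * B * ((1 - \<alpha>) / (1 - t))"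
      unfolding rec S double by (simp add: 3 component_const_def mult_ac)
    also have "\<dots> = torus_const t m / 2 * ((1 - \<alpha>) * B + (-1) ^ l * (1 + \<alpha>) * A)"
    proof -
      have "m > 0 \<or> B = 0" using B0 3 by simp
      then show ?thesis
        unfolding Q[OF \<open>m > 0 \<or> B = 0\<close>] halve[OF nz(1)] by (simp only: distrib_left add.commute)
    qed
    finally show ?thesis unfolding AB(2) by (simp add: 3 component_const_def flip: m_def)
  next
    case 4
    have d: "{1, -1} - {1} = {-1 :: complex}" "{1, -1} - {-1} = {1 :: complex}" by auto
    have k: "hl_kernel t 1 (-1) = (1 + t) / 2" "hl_kernel t (-1) 1 = (1 + t) / 2"
      by (simp_all add: hl_kernel_def field_simps)
    have "hl_integral t \<alpha> Y I (l # ls) =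
      (1 + t) / 2 * torus_const t m * ((1 - \<alpha>) * B + (-1) ^ l * (1 + \<alpha>) * A)"
      unfolding rec by (simp add: 4 d k component_const_def field_simps)
    then show ?thesis unfolding AB(2) by (simp add: 4 component_const_def flip: m_def)
  qed
qed

section \<open>The integrals of the theorem\<close>

lemma pm_args_Suc: "pm_args (Suc n) x = pm_args n x @ [x n, inverse (x n)]"
  by (simp add: pm_args_def)

lemma length_pm_args [simp]: "length (pm_args n x) = 2 * n"
  by (induction n) (simp_all add: pm_args_Suc, simp add: pm_args_def)

lemma nth_pm_args:
  "k < 2 * n \<Longrightarrow> pm_args n x ! k = (if even k then x (k div 2) else inverse (x (k div 2)))"
proof (induction n)
  case (Suc n)
  have "k < 2 * n \<or> k = 2 * n \<or> k = Suc (2 * n)" using Suc.prems by auto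
  then show ?case
    by (elim disjE) (use Suc.IH in \<open>auto simp: pm_args_Suc nth_append\<close>)
qed simp

lemma hall_littlewood_eq_letters:
  assumes "length lam = 2 * n + 1"
  shows "hall_littlewood lam (pm_args n x @ [- 1]) t =
    1 / HL_v lam t * hl_sum t lam (letters {..<n} {-1}) (letter_val x)"
proof -
  define h where "h k = (if k = 2 * n then Fix (-1) else if even k then Var (k div 2) else Inv (k div 2))" for k
  have inj: "inj_on h {..<2 * n + 1}"
    by (auto simp: inj_on_def h_def split: if_splits elim!: evenE oddE)
  have "h ` {..<2 * n + 1} \<subseteq> letters {..<n} {-1}"
    by (auto simp: h_def letters_def)
  moreover have "card (h ` {..<2 * n + 1}) = card (letters {..<n} {-1})"
    using card_image[OF inj] by (simp add: card_letters)
  ultimately have img: "h ` {..<2 * n + 1} = letters {..<n} {-1}"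
    by (intro card_subset_eq) auto
  have "hl_sum t lam {..<2 * n + 1} ((!) (pm_args n x @ [- 1])) =
    hl_sum t lam {..<2 * n + 1} (letter_val x \<circ> h)"
    by (rule hl_sum_cong) (auto simp: h_def nth_append nth_pm_args)
  also have "\<dots> = hl_sum t lam (letters {..<n} {-1}) (letter_val x)"
    unfolding img[symmetric] by (rule hl_sum_reindex[OF inj, symmetric])
  finally show ?thesis unfolding hall_littlewood_eq_hl_sum assms by simp
qed

lemma koornwinder_density_eq_torus_weight:
  assumes x: "generic_point {..<n} x" and s: "s\<^sup>2 = t"
  shows "koornwinder_density n x 1 (- t) s (- s) t = 1 / (2 ^ n * fact n) * torus_weight t {-1} {..<n} x"
proof -
  have "one_minus_pm 1 ((x i)\<^sup>2) / (one_minus_pm 1 (x i) * one_minus_pm (- t) (x i) *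
      one_minus_pm s (x i) * one_minus_pm (- s) (x i)) = var_weight t {-1} (x i)" if i: "i < n" for i
  proof -
    let ?u = "x i"
    have u: "norm ?u = 1" "?u \<noteq> 1" using generic_point_neq_sign[OF x, of i] i by auto
    then have u0: "?u \<noteq> 0" "inverse ?u \<noteq> 1" by auto
    then have ne: "one_minus_pm 1 ?u \<noteq> 0" using u by (simp add: one_minus_pm_def)
    have 1: "one_minus_pm 1 (?u\<^sup>2) = one_minus_pm 1 ?u * one_minus_pm (-1) ?u"
      by (simp add: one_minus_pm_def power2_eq_square algebra_simps)
    have 2: "one_minus_pm s ?u * one_minus_pm (- s) ?u = one_minus_pm t (?u\<^sup>2)"
      unfolding s[symmetric] by (simp add: one_minus_pm_def power2_eq_square algebra_simps)
    show ?thesis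
      unfolding mult.assoc[of _ "one_minus_pm s ?u"] 1 2 var_weight_def using ne by simp
  qed
  moreover have "(\<Prod>j<n. \<Prod>i | i \<in> {..<n} \<and> i < j. pair_weight t (x i) (x j)) =
      (\<Prod>j<n. \<Prod>i<j. pair_weight t (x i) (x j))"
    by (intro prod.cong) auto
  ultimately show ?thesis
    unfolding koornwinder_density_def torus_weight_def by (simp add: pair_weight_def)
qed

lemma torus_integral_eq: "torus_integral n f = (LINT \<theta>|torus_measure {..<n}. f (torus_point \<theta>))"
  by (simp add: torus_integral_def circle_measure_def)

lemma measurable_koornwinder_density:
  "(\<lambda>\<theta>. koornwinder_density n (torus_point \<theta>) a b c d t) \<in> borel_measurable (torus_measure {..<n})"
  unfolding koornwinder_density_def one_minus_pm_def one_minus_pm2_def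
  by (intro borel_measurable_sum borel_measurable_times borel_measurable_prod borel_measurable_power
      borel_measurable_divide borel_measurable_diff borel_measurable_inverse measurable_torus_point
      borel_measurable_const) auto

lemma numerator_eq_hl_integral:
  assumes s: "s\<^sup>2 = t" and lam: "length lam = 2 * n + 1"
  shows "(1 + \<alpha>) * torus_integral n (\<lambda>x. hall_littlewood lam (pm_args n x @ [- 1]) t *
      koornwinder_density n x 1 (- t) s (- s) t * (\<Prod>i<n. one_minus_pm \<alpha> (x i))) =
    1 / HL_v lam t * (1 / (2 ^ n * fact n)) * hl_integral t \<alpha> {-1} {..<n} lam"
proof -
  have "(LINT \<theta>|torus_measure {..<n}. (1 + \<alpha>) * (hall_littlewood lam (pm_args n (torus_point \<theta>) @ [- 1]) t *
      koornwinder_density n (torus_point \<theta>) 1 (- t) s (- s) t * (\<Prod>i<n. one_minus_pm \<alpha> (torus_point \<theta> i)))) =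
    (LINT \<theta>|torus_measure {..<n}. 1 / HL_v lam t * (1 / (2 ^ n * fact n)) *
      hl_integrand t \<alpha> {-1} {..<n} lam (torus_point \<theta>))"
  proof (rule integral_cong_AE)
    show "AE \<theta> in torus_measure {..<n}. (1 + \<alpha>) * (hall_littlewood lam (pm_args n (torus_point \<theta>) @ [- 1]) t *
      koornwinder_density n (torus_point \<theta>) 1 (- t) s (- s) t * (\<Prod>i<n. one_minus_pm \<alpha> (torus_point \<theta> i))) =
      1 / HL_v lam t * (1 / (2 ^ n * fact n)) * hl_integrand t \<alpha> {-1} {..<n} lam (torus_point \<theta>)"
      using AE_generic_point[OF finite_lessThan]
    proof eventually_elim
      case (elim \<theta>)
      have "(\<Prod>a\<in>letters {..<n} {-1}. 1 - \<alpha> * letter_val (torus_point \<theta>) a) =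
        (1 + \<alpha>) * (\<Prod>i<n. one_minus_pm \<alpha> (torus_point \<theta> i))"
        by (simp add: prod_letters one_minus_pm_def)
      then show ?case
        unfolding hall_littlewood_eq_letters[OF lam] koornwinder_density_eq_torus_weight[OF elim s] hl_integrand_def
        by (simp add: mult_ac)
    qed
    show "(\<lambda>\<theta>. (1 + \<alpha>) * (hall_littlewood lam (pm_args n (torus_point \<theta>) @ [- 1]) t *
      koornwinder_density n (torus_point \<theta>) 1 (- t) s (- s) t * (\<Prod>i<n. one_minus_pm \<alpha> (torus_point \<theta> i))))
      \<in> borel_measurable (torus_measure {..<n})"
      unfolding hall_littlewood_eq_letters[OF lam] one_minus_pm_def
      by (intro borel_measurable_times borel_measurable_prod borel_measurable_diff borel_measurable_const
          borel_measurable_inverse measurable_hl_sum measurable_letter_val measurable_koornwinder_density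
          measurable_torus_point) auto
  qed (intro borel_measurable_times borel_measurable_const measurable_hl_integrand)
  then show ?thesis
    unfolding torus_integral_eq hl_integral_def by (simp only: integral_mult_right_zero)
qed

lemma denominator_eq_hl_integral:
  assumes s: "s\<^sup>2 = t" and t: "norm t < 1"
  shows "t_fact t (2 * n + 1) * torus_integral n (\<lambda>x. koornwinder_density n x 1 (- t) s (- s) t) =
    1 / (2 ^ n * fact n) * hl_integral t 0 {-1} {..<n} (replicate (2 * n + 1) 0)"
proof -
  have "(LINT \<theta>|torus_measure {..<n}. t_fact t (2 * n + 1) * koornwinder_density n (torus_point \<theta>) 1 (- t) s (- s) t) =
    (LINT \<theta>|torus_measure {..<n}. 1 / (2 ^ n * fact n) *
      hl_integrand t 0 {-1} {..<n} (replicate (2 * n + 1) 0) (torus_point \<theta>))"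
  proof (rule integral_cong_AE)
    show "AE \<theta> in torus_measure {..<n}. t_fact t (2 * n + 1) * koornwinder_density n (torus_point \<theta>) 1 (- t) s (- s) t =
      1 / (2 ^ n * fact n) * hl_integrand t 0 {-1} {..<n} (replicate (2 * n + 1) 0) (torus_point \<theta>)"
      using AE_generic_point[OF finite_lessThan]
    proof eventually_elim
      case (elim \<theta>)
      have "hl_sum t (replicate (2 * n + 1) 0) (letters {..<n} {-1}) (letter_val (torus_point \<theta>)) =
        t_fact t (2 * n + 1)"
      proof (rule hl_sum_zero_partition)
        show "inj_on (letter_val (torus_point \<theta>)) (letters {..<n} {-1})"
          using elim letters_mono[of "{-1}" "{1, -1}"] by (auto simp: generic_point_def intro: inj_on_subset)
        show "\<forall>a\<in>letters {..<n} {-1}. letter_val (torus_point \<theta>) a \<noteq> 0"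
          by (auto simp: letters_def)
      qed (use t in \<open>auto simp: card_letters\<close>)
      then show ?case
        unfolding koornwinder_density_eq_torus_weight[OF elim s] hl_integrand_def by simp
    qed
  qed (intro borel_measurable_times borel_measurable_const measurable_hl_integrand measurable_koornwinder_density)+
  then show ?thesis
    unfolding torus_integral_eq hl_integral_def by (simp only: integral_mult_right_zero)
qed

theorem theorem4p7:
  fixes n :: nat and lam :: "nat list" and t s \<alpha> :: complex
  assumes t: "norm t < 1"
    and s: "s\<^sup>2 = t"
    and lam: "is_partition (2 * n + 1) lam"
  shows "(1 + \<alpha>) / torus_integral n (\<lambda>x. koornwinder_density n x 1 (- t) s (- s) t) *
      torus_integral n (\<lambda>x.
        hall_littlewood lam (pm_args n x @ [- 1]) t *
        koornwinder_density n x 1 (- t) s (- s) t *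
        (\<Prod>i<n. one_minus_pm \<alpha> (x i)))
    = t_phi (2 * n + 1) t / (HL_v lam t * (1 - t) ^ (2 * n + 1)) *
      ((- \<alpha>) ^ length (filter odd lam) - (- \<alpha>) ^ length (filter even lam))"
proof -
  let ?N = "2 * n + 1"
  let ?D = "torus_integral n (\<lambda>x. koornwinder_density n x 1 (- t) s (- s) t)"
  define c where "c = 1 / (2 ^ n * fact n) * torus_const t n"
  have len: "length lam = ?N" and sorted: "sorted_wrt (\<ge>) lam"
    using lam by (auto simp: is_partition_def)
  have c0: "c \<noteq> 0" using t by (auto simp: c_def torus_const_def)
  have "t_fact t ?N = (\<Prod>i=1..?N. 1 - t ^ i) / (\<Prod>i=1..?N. 1 - t)"
    unfolding t_fact_def t_int_def by (rule prod_dividef)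
  then have fact: "t_fact t ?N = t_phi ?N t / (1 - t) ^ ?N"
    by (simp add: t_phi_def)
  have "sorted_wrt (\<ge>) (replicate k (0 :: nat))" for k
    by (induction k) auto
  then have "hl_integral t 0 {-1} {..<n} (replicate ?N 0) = torus_const t n"
    using hl_integral_eval[of "{..<n}" "{-1}" t "replicate ?N 0" 0] t
    by (simp add: component_const_def parity_sum_def del: replicate_Suc)
  then have D: "t_fact t ?N * ?D = c"
    using denominator_eq_hl_integral[OF s t, of n] by (simp add: c_def)
  then have D0: "?D \<noteq> 0" using c0 by auto
  have "hl_integral t \<alpha> {-1} {..<n} lam = torus_const t n *
      ((- \<alpha>) ^ length (filter odd lam) - (- \<alpha>) ^ length (filter even lam))"
    using hl_integral_eval[of "{..<n}" "{-1}" t lam \<alpha>] t len sorted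
    by (simp add: component_const_def parity_sum_def)
  then have num: "(1 + \<alpha>) * torus_integral n (\<lambda>x. hall_littlewood lam (pm_args n x @ [- 1]) t *
      koornwinder_density n x 1 (- t) s (- s) t * (\<Prod>i<n. one_minus_pm \<alpha> (x i))) =
    c * (1 / HL_v lam t * ((- \<alpha>) ^ length (filter odd lam) - (- \<alpha>) ^ length (filter even lam)))"
    unfolding numerator_eq_hl_integral[OF s len] c_def by simp
  have cD: "c / ?D = t_fact t ?N" using D D0 by (simp add: field_simps)
  have regroup: "a / b * (1 * e / v) = a * e / (v * b)" for a b v e :: complex by simp
  show ?thesis
    unfolding times_divide_eq_left num
    unfolding times_divide_eq_left[symmetric, of c] cD fact by (rule regroup)
qed

end
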